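(* Consider the one-dimensional case $d=1$, with the random coefficient $A_\eta$, the apparent homogenized coefficient $A^\star_{\eta,N}$ and the first-order controlled variable $D^{1,\eta}_\rho$ as defined in the context, where $\eta\in(0,1)$ is fixed. Then, as $N\to\infty$, $$\mathrm{Var}\big(A^\star_{\eta,N}\big)=\frac{C}{N}+O\!\left(\frac1{N^2}\right)$$ for some constant $C$ independent of $N$, and, for the optimal value $\rho^\star$ of the deterministic parameter $\rho\in\mathbb{R}$ (i.e. $\rho^\star$ is a minimizer of $\rho\mapsto\mathrm{Var}(D^{1,\eta}_\rho)$; it may depend on $N$ and $\eta$), $$\min_{\rho\in\mathbb{R}}\mathrm{Var}\big(D^{1,\eta}_\rho\big)=\mathrm{Var}\big(D^{1,\eta}_{\rho^\star}\big)=O\!\left(\frac1{N^2}\right).$$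
   Context: Let $d=1$, $Q=(0,1)$, and for a positive integer $N$ let $Q_N=(0,N)$ and $\mathcal{I}_N=\{k\in\mathbb{Z}:\ k+Q\subset Q_N\}=\{0,\dots,N-1\}$. Let $A_{\rm per},C_{\rm per}:\mathbb{R}\to\mathbb{R}$ be measurable, $\mathbb{Z}$-periodic, bounded, and bounded from below by a positive constant. Let $\eta\in(0,1)$ and let $(B^\eta_k)_{k\in\mathbb{Z}}$ be i.i.d. Bernoulli random variables on a probability space $(\Omega,\mathcal F,\mathbb P)$: $\mathbb{P}(B^\eta_k=1)=\eta$, $\mathbb{P}(B^\eta_k=0)=1-\eta$. Set $$A_\eta(x,\omega)=A_{\rm per}(x)+\Big(\sum_{k\in\mathbb{Z}}\mathbf 1_{Q+k}(x)B^\eta_k(\omega)\Big)\big(C_{\rm per}(x)-A_{\rm per}(x)\big).$$ Apparent homogenized coefficient on $Q_N$: for a bounded measurable coefficient $A$ on $Q_N$ bounded from below by a positive constant (extended $Q_N$-periodically), and $p\in\mathbb{R}$, let $w_p^N$ be the $Q_N$-periodic weak solution (unique up to an additive constant) of $-\big(A(p+(w_p^N)')\big)'=0$, and define the number $\mathrm{Hom}_N(A)$ by $\mathrm{Hom}_N(A)\,p=\frac1{|Q_N|}\int_{Q_N}A\,(p+(w_p^N)')\,dx$ for all $p\in\mathbb{R}$. Then define: - $A^\star_{\eta,N}(\omega)=\mathrm{Hom}_N(A_\eta(\cdot,\omega))$; - $A^\star_{\rm per}$: the periodic homogenized coefficient, given by $A^\star_{\rm per}\,p=\int_Q A_{\rm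 per}(p+(w_p^0)')\,dx$ with $w_p^0$ the $Q$-periodic solution of $-\big(A_{\rm per}(p+(w_p^0)')\big)'=0$; - for $k\in\mathcal I_N$, $A^\star_{1,k,N}=\mathrm{Hom}_N\big(A_{\rm per}+\mathbf 1_{k+Q}(C_{\rm per}-A_{\rm per})\big)$ (a single defect in $k+Q$), and $\overline A^{k,N}_{1\,\rm def}=A^\star_{1,k,N}-A^\star_{\rm per}$; - $A^{\eta,N}_1(\omega)=\sum_{k\in\mathcal I_N}B^\eta_k(\omega)\,\overline A^{k,N}_{1\,\rm def}$ and $\overline A^N_1=\sum_{k\in\mathcal I_N}\overline A^{k,N}_{1\,\rm def}$, so that $\mathbb E[A^{\eta,N}_1]=\eta\overline A^N_1$. The first-order controlled variable is, for a deterministic $\rho\in\mathbb{R}$, $$D^{1,\eta}_\rho(\omega)=A^\star_{\eta,N}(\omega)-\rho\big(A^{\eta,N}_1(\omega)-\eta\overline A^N_1\big).$$ The constants in the $O(\cdot)$ terms are independent of $N$ (they may depend on $\eta$, $A_{\rm per}$, $C_{\rm per}$). The parameter $\eta$ is not assumed to be small. *)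

theory Defs
  imports "HOL-Probability.Probability" "HOL-Library.Landau_Symbols"
begin

text \<open>The class of compactly supported \<open>C\<^sup>1\<close> test functions is the usual one for Sobolev
  spaces on intervals (e.g. Brezis, Chapter 8).\<close>

definition test_function :: "(real \<Rightarrow> real) \<Rightarrow> bool" where
  "test_function \<phi> \<longleftrightarrow> \<phi> C1_differentiable_on UNIV \<and> compact (closure {x. \<phi> x \<noteq> 0})"

definition L2_loc :: "(real \<Rightarrow> real) \<Rightarrow> bool" where
  "L2_loc f \<longleftrightarrow> f \<in> borel_measurable lebesgue \<and>
     (\<forall>a b. set_integrable lebesgue {a..b} (\<lambda>x. (f x)\<^sup>2))"

definition weak_derivative :: "(real \<Rightarrow> real) \<Rightarrow> (real \<Rightarrow> real) \<Rightarrow> bool" where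
  "weak_derivative w g \<longleftrightarrow>
     (\<forall>\<phi>. test_function \<phi> \<longrightarrow>
        (LINT x|lebesgue. w x * deriv \<phi> x) = - (LINT x|lebesgue. g x * \<phi> x))"

text \<open>\<open>H1_per L w g\<close>: \<open>w\<close> is an \<open>L\<close>-periodic function in \<open>H\<^sup>1\<^sub>l\<^sub>o\<^sub>c\<close> of the line, and \<open>g\<close> is (a
  representative of) its weak derivative.\<close>

definition H1_per :: "real \<Rightarrow> (real \<Rightarrow> real) \<Rightarrow> (real \<Rightarrow> real) \<Rightarrow> bool" where
  "H1_per L w g \<longleftrightarrow>
     L2_loc w \<and> L2_loc g \<and> (\<forall>x. w (x + L) = w x) \<and> weak_derivative w g"

text \<open>Weak form of \<open>-(A (p + w'))' = 0\<close> with periodic boundary conditions on \<open>(0, L)\<close>, where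
  \<open>g = w'\<close>. Only the values of \<open>A\<close> on \<open>(0, L)\<close> enter, so the \<open>L\<close>-periodic extension of \<open>A\<close>
  need not be formed.\<close>

definition periodic_weak_solution ::
  "real \<Rightarrow> (real \<Rightarrow> real) \<Rightarrow> real \<Rightarrow> (real \<Rightarrow> real) \<Rightarrow> (real \<Rightarrow> real) \<Rightarrow> bool" where
  "periodic_weak_solution L A p w g \<longleftrightarrow>
     H1_per L w g \<and>
     (\<forall>\<phi> \<psi>. H1_per L \<phi> \<psi> \<longrightarrow>
        (LINT x:{0<..<L}|lebesgue. A x * (p + g x) * \<psi> x) = 0)"

text \<open>The solution \<open>w\<close> is unique up to an additive constant, so the flux average below does not
  depend on the choice of \<open>(w, g)\<close>.\<close>

definition hom_coeff :: "real \<Rightarrow> (real \<Rightarrow> real) \<Rightarrow> real" where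
  "hom_coeff L A =
     (THE h. \<forall>p. \<exists>w g. periodic_weak_solution L A p w g \<and>
        h * p = (1 / L) * (LINT x:{0<..<L}|lebesgue. A x * (p + g x)))"

definition periodic_coefficient :: "(real \<Rightarrow> real) \<Rightarrow> bool" where
  "periodic_coefficient A \<longleftrightarrow>
     A \<in> borel_measurable lebesgue \<and>
     (\<forall>x. \<forall>k::int. A (x + of_int k) = A x) \<and>
     (\<exists>b. \<forall>x. A x \<le> b) \<and>
     (\<exists>a>0. \<forall>x. a \<le> A x)"

definition cell :: "int \<Rightarrow> real set" where
  "cell k = {of_int k <..< of_int k + 1}"

definition cells_in :: "nat \<Rightarrow> int set" where
  "cells_in N = {k. cell k \<subseteq> {0 <..< real N}}"

definition A_rand ::
  "(real \<Rightarrow> real) \<Rightarrow> (real \<Rightarrow> real) \<Rightarrow> (int \<Rightarrow> 'w \<Rightarrow> bool) \<Rightarrow> 'w \<Rightarrow> real \<Rightarrow> real" where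
  "A_rand Aper Cper B \<omega> x =
     Aper x + (\<Sum>\<^sub>\<infinity>k. indicator (cell k) x * of_bool (B k \<omega>)) * (Cper x - Aper x)"

definition A_star ::
  "(real \<Rightarrow> real) \<Rightarrow> (real \<Rightarrow> real) \<Rightarrow> (int \<Rightarrow> 'w \<Rightarrow> bool) \<Rightarrow> nat \<Rightarrow> 'w \<Rightarrow> real" where
  "A_star Aper Cper B N \<omega> = hom_coeff (real N) (A_rand Aper Cper B \<omega>)"

definition A_star_per :: "(real \<Rightarrow> real) \<Rightarrow> real" where
  "A_star_per Aper = hom_coeff 1 Aper"

definition A_star_one_defect :: "(real \<Rightarrow> real) \<Rightarrow> (real \<Rightarrow> real) \<Rightarrow> nat \<Rightarrow> int \<Rightarrow> real" where
  "A_star_one_defect Aper Cper N k =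
     hom_coeff (real N) (\<lambda>x. Aper x + indicator (cell k) x * (Cper x - Aper x))"

definition A_one_def :: "(real \<Rightarrow> real) \<Rightarrow> (real \<Rightarrow> real) \<Rightarrow> nat \<Rightarrow> int \<Rightarrow> real" where
  "A_one_def Aper Cper N k = A_star_one_defect Aper Cper N k - A_star_per Aper"

definition A_one ::
  "(real \<Rightarrow> real) \<Rightarrow> (real \<Rightarrow> real) \<Rightarrow> (int \<Rightarrow> 'w \<Rightarrow> bool) \<Rightarrow> nat \<Rightarrow> 'w \<Rightarrow> real" where
  "A_one Aper Cper B N \<omega> = (\<Sum>k\<in>cells_in N. of_bool (B k \<omega>) * A_one_def Aper Cper N k)"

definition A_one_bar :: "(real \<Rightarrow> real) \<Rightarrow> (real \<Rightarrow> real) \<Rightarrow> nat \<Rightarrow> real" where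
  "A_one_bar Aper Cper N = (\<Sum>k\<in>cells_in N. A_one_def Aper Cper N k)"

definition D_one ::
  "(real \<Rightarrow> real) \<Rightarrow> (real \<Rightarrow> real) \<Rightarrow> real \<Rightarrow> (int \<Rightarrow> 'w \<Rightarrow> bool) \<Rightarrow> nat \<Rightarrow> real \<Rightarrow> 'w \<Rightarrow> real" where
  "D_one Aper Cper \<eta> B N \<rho> \<omega> =
     A_star Aper Cper B N \<omega> - \<rho> * (A_one Aper Cper B N \<omega> - \<eta> * A_one_bar Aper Cper N)"

end

theory Submission
  imports Defs
begin

text \<open>In one dimension the homogenized coefficient on \<open>(0, L)\<close> is the harmonic mean
  \<open>L / \<integral> 1/A\<close> (\<open>hom_coeff_eq_harmonic_mean\<close>). The cell integrals of \<open>1 / A\<^sub>p\<^sub>e\<^sub>r\<close> and \<open>1 / C\<^sub>p\<^sub>e\<^sub>r\<close> are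
  two numbers \<open>\<alpha>, \<beta>\<close>, so that (\<open>hom_coeff_defects\<close>)
  \<open>A\<^sup>\<star> = 1 / (m + \<delta> Y)\<close> with \<open>\<delta> = \<beta> - \<alpha>\<close> and \<open>m = \<alpha> + \<eta> \<delta>\<close>, where \<open>Y\<close> is the
  average of the \<open>N\<close> independent centered variables \<open>B\<^sub>k - \<eta>\<close>. A problem about random differential equations
  becomes one about a smooth function of an empirical mean.

  The variance of \<open>Y\<close> is \<open>\<eta> (1 - \<eta>) / N\<close>, while its third and fourth moments are of order
  \<open>1 / N\<^sup>2\<close> (\<open>moments_indep_sum\<close>). A Taylor expansion at \<open>Y = 0\<close> therefore gives
  \<open>Var A\<^sup>\<star> = \<delta>\<^sup>2 \<eta> (1 - \<eta>) / (m\<^sup>4 N) + O(1 / N\<^sup>2)\<close>, where the leading term is the contribution of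
  the linear part (\<open>reciprocal_affine_variance\<close>).

  All single defects have the same effect, so the centered first-order variable is a multiple of
  \<open>Y\<close>, and a nonzero one unless \<open>\<delta> = 0\<close>. A suitable \<open>\<rho>\<close> thus removes the linear part exactly. What remains is a
  quadratic remainder of variance \<open>O(1 / N\<^sup>2)\<close>, and the optimal \<open>\<rho>\<close> can only do better.\<close>

section \<open>Weak derivatives of periodic functions have mean zero\<close>

definition ramp_square :: "real \<Rightarrow> real" where
  "ramp_square s = (max 0 s)\<^sup>2"

lemma ramp_square_deriv: "(ramp_square has_real_derivative 2 * max 0 s) (at s)"
proof -
  consider "s < 0" | "s > 0" | "s = 0" by linarith
  then show ?thesis
  proof cases
    case 1
    have "((\<lambda>_. 0) has_real_derivative 2 * max 0 s) (at s)"
      using 1 by auto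
    then show ?thesis
      by (rule has_field_derivative_transform_within_open[of _ _ _ "{..<0}"])
        (use 1 in \<open>auto simp: ramp_square_def\<close>)
  next
    case 2
    have "((\<lambda>x. x\<^sup>2) has_real_derivative 2 * max 0 s) (at s)"
      using 2 by (auto intro!: derivative_eq_intros)
    then show ?thesis
      by (rule has_field_derivative_transform_within_open[of _ _ _ "{0<..}"])
        (use 2 in \<open>auto simp: ramp_square_def\<close>)
  next
    case 3
    have "((\<lambda>y. max 0 y * (max 0 y / y)) \<longlongrightarrow> 0) (at (0::real))"
    proof (rule Lim_null_comparison)
      show "\<forall>\<^sub>F y in at (0::real). norm (max 0 y * (max 0 y / y)) \<le> \<bar>y\<bar>"
        by (rule always_eventually) (auto simp: max_def)
      show "((\<lambda>y::real. \<bar>y\<bar>) \<longlongrightarrow> 0) (at 0)"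
        by (rule tendsto_eq_intros tendsto_ident_at | simp)+
    qed
    then show ?thesis
      using 3 by (simp add: has_field_derivative_iff ramp_square_def power2_eq_square)
  qed
qed

text \<open>A quadratic spline: its derivative is the continuous hat function on \<open>[0, 1]\<close> of total mass
  one, so it rises from \<open>0\<close> to \<open>1\<close>; test functions are \<open>C\<^sup>1\<close>, and a spline of this order suffices.\<close>

definition smooth_step :: "real \<Rightarrow> real" where
  "smooth_step s = 2 * (ramp_square s - 2 * ramp_square (s - 1/2) + ramp_square (s - 1))"

definition smooth_step' :: "real \<Rightarrow> real" where
  "smooth_step' s = 4 * (max 0 s - 2 * max 0 (s - 1/2) + max 0 (s - 1))"

lemma smooth_step_deriv: "(smooth_step has_real_derivative smooth_step' s) (at s)"
proof -
  have shift: "((\<lambda>s. ramp_square (s - c)) has_real_derivative 2 * max 0 (s - c)) (at s)" for c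
  proof -
    have "((\<lambda>s. ramp_square (s - c)) has_real_derivative 2 * max 0 (s - c) * 1) (at s)"
      by (rule DERIV_chain2[OF ramp_square_deriv]) (auto intro!: derivative_eq_intros)
    then show ?thesis by simp
  qed
  show ?thesis
    unfolding smooth_step_def smooth_step'_def
    by (rule derivative_eq_intros ramp_square_deriv shift refl)+ (simp add: algebra_simps)
qed

lemma smooth_step_left: "s \<le> 0 \<Longrightarrow> smooth_step s = 0"
  by (simp add: smooth_step_def ramp_square_def)

lemma smooth_step_right: "s \<ge> 1 \<Longrightarrow> smooth_step s = 1"
  by (simp add: smooth_step_def ramp_square_def power2_eq_square algebra_simps)

lemma smooth_step_bounds: "0 \<le> smooth_step s" "smooth_step s \<le> 1"
proof -
  consider "s \<le> 0" | "0 < s" "s \<le> 1/2" | "1/2 < s" "s < 1" | "1 \<le> s" by linarith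
  then have "0 \<le> smooth_step s \<and> smooth_step s \<le> 1"
  proof cases
    case 2
    have "s\<^sup>2 \<le> (1/2)\<^sup>2" using 2 by (intro power_mono) auto
    then show ?thesis using 2 by (simp add: smooth_step_def ramp_square_def power2_eq_square)
  next
    case 3
    have "smooth_step s = 1 - 2 * (1 - s)\<^sup>2"
      using 3 by (simp add: smooth_step_def ramp_square_def power2_eq_square field_simps)
    moreover have "(1 - s)\<^sup>2 \<le> (1/2)\<^sup>2" using 3 by (intro power_mono) auto
    ultimately show ?thesis by (simp add: power2_eq_square)
  qed (auto simp: smooth_step_left smooth_step_right)
  then show "0 \<le> smooth_step s" "smooth_step s \<le> 1" by auto
qed

lemma continuous_smooth_step': "continuous_on S smooth_step'"
  unfolding smooth_step'_def by (intro continuous_intros)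

lemma smooth_step'_support: "s \<notin> {0..1} \<Longrightarrow> smooth_step' s = 0"
  by (auto simp: smooth_step'_def max_def)

text \<open>A \<open>C\<^sup>1\<close> approximation of the indicator of \<open>(0, L]\<close>. The descending flank is the exact translate
  by \<open>L\<close> of the ascending one: against an \<open>L\<close>-periodic function the two flanks of the derivative
  cancel for every \<open>n\<close>, and not only in the limit.\<close>

definition plateau :: "real \<Rightarrow> nat \<Rightarrow> real \<Rightarrow> real" where
  "plateau L n x = smooth_step (real (Suc n) * x) - smooth_step (real (Suc n) * (x - L))"

lemma plateau_deriv:
  "(plateau L n has_real_derivative
     real (Suc n) * (smooth_step' (real (Suc n) * x) - smooth_step' (real (Suc n) * (x - L)))) (at x)"
proof -
  have "((\<lambda>x. smooth_step (real (Suc n) * (x - c))) has_real_derivative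
      smooth_step' (real (Suc n) * (x - c)) * real (Suc n)) (at x)" for c
    by (rule DERIV_chain2[OF smooth_step_deriv]) (auto intro!: derivative_eq_intros)
  from DERIV_diff[OF this[of 0] this[of L]] show ?thesis
    unfolding plateau_def by (simp add: algebra_simps)
qed

lemma plateau_support:
  assumes "L \<ge> 0" "x \<notin> {0..L+1}"
  shows "plateau L n x = 0"
proof (cases "x < 0")
  case True
  then have "real (Suc n) * x \<le> 0" "real (Suc n) * (x - L) \<le> 0"
    using assms by (auto simp: mult_le_0_iff simp del: of_nat_Suc)
  then show ?thesis by (simp add: plateau_def smooth_step_left)
next
  case False
  then have x: "x - L \<ge> 1" using assms by auto
  have "1 * 1 \<le> real (Suc n) * (x - L)" using x by (intro mult_mono) auto
  moreover have "1 * 1 \<le> real (Suc n) * x" using x assms by (intro mult_mono) auto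
  ultimately show ?thesis by (simp add: plateau_def smooth_step_right)
qed

lemma plateau_bound: "\<bar>plateau L n x\<bar> \<le> 1"
  using smooth_step_bounds[of "real (Suc n) * x"] smooth_step_bounds[of "real (Suc n) * (x - L)"]
  unfolding plateau_def by linarith

lemma smooth_step_dilation_tendsto:
  "(\<lambda>n. smooth_step (real (Suc n) * x)) \<longlonglongrightarrow> indicator {0<..} x"
proof (cases "x > 0")
  case True
  obtain m :: nat where m: "1 / x < real m" using reals_Archimedean2 by blast
  have "\<forall>\<^sub>F n in sequentially. smooth_step (real (Suc n) * x) = 1"
  proof (rule eventually_sequentiallyI[of m])
    fix n assume "m \<le> n"
    then have "1 / x \<le> real (Suc n)" using m by linarith
    then show "smooth_step (real (Suc n) * x) = 1"
      using True by (intro smooth_step_right) (simp add: field_simps)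
  qed
  then show ?thesis using True by (simp add: tendsto_eventually)
next
  case False
  then have "smooth_step (real (Suc n) * x) = 0" for n
    by (intro smooth_step_left) (auto simp: mult_le_0_iff simp del: of_nat_Suc)
  then show ?thesis using False by simp
qed

lemma plateau_tendsto:
  assumes "L \<ge> 0"
  shows "(\<lambda>n. plateau L n x) \<longlonglongrightarrow> indicator {0<..L} x"
proof -
  have "indicator {0<..L} x = (indicator {0<..} x - indicator {0<..} (x - L) :: real)"
    using assms by (auto simp: indicator_def)
  then show ?thesis
    unfolding plateau_def
    by (simp only:) (intro tendsto_diff smooth_step_dilation_tendsto)
qed

lemma test_function_plateau:
  assumes "L \<ge> 0"
  shows "test_function (plateau L n)"
  unfolding test_function_def C1_differentiable_on_def
proof (intro conjI exI ballI)
  show "(plateau L n has_vector_derivative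
     real (Suc n) * (smooth_step' (real (Suc n) * x) - smooth_step' (real (Suc n) * (x - L)))) (at x)" for x
    using plateau_deriv[of L n x] by (simp add: has_real_derivative_iff_has_vector_derivative)
  show "continuous_on UNIV (\<lambda>x. real (Suc n) *
      (smooth_step' (real (Suc n) * x) - smooth_step' (real (Suc n) * (x - L))))"
    by (intro continuous_intros continuous_on_compose2[OF continuous_smooth_step'[of UNIV]]) auto
  have "{x. plateau L n x \<noteq> 0} \<subseteq> {0..L+1}"
    using plateau_support[OF assms] by blast
  then show "compact (closure {x. plateau L n x \<noteq> 0})"
    by (meson bounded_closed_interval bounded_subset compact_closure)
qed

lemma L2_loc_set_integrable:
  assumes "L2_loc f"
  shows "set_integrable lebesgue {a..b} f"
proof -
  have f[measurable]: "f \<in> borel_measurable lebesgue"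
    and sq: "set_integrable lebesgue {a..b} (\<lambda>x. (f x)\<^sup>2)"
    using assms by (auto simp: L2_loc_def)
  have "set_integrable lebesgue {a..b} (\<lambda>x. 1 + (f x)\<^sup>2)"
    using sq by (intro set_integral_add) auto
  then show ?thesis
  proof (rule set_integrable_bound)
    show "set_borel_measurable lebesgue {a..b} f"
      unfolding set_borel_measurable_def by (intro borel_measurable_scaleR borel_measurable_indicator f) simp
    have "\<bar>y\<bar> \<le> 1 + y\<^sup>2" for y :: real
    proof -
      have "0 \<le> (\<bar>y\<bar> - 1)\<^sup>2 + y\<^sup>2 + 1" by simp
      then show ?thesis by (simp add: power2_eq_square algebra_simps)
    qed
    then show "AE x in lebesgue. x \<in> {a..b} \<longrightarrow> norm (f x) \<le> norm (1 + (f x)\<^sup>2)"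
      by (auto intro!: AE_I2 simp: abs_of_nonneg add_nonneg_nonneg)
  qed
qed

lemma integrable_mult_bounded_support:
  fixes f h :: "real \<Rightarrow> real"
  assumes f: "set_integrable lebesgue {a..b} f"
    and h: "h \<in> borel_measurable lebesgue" "\<And>x. \<bar>h x\<bar> \<le> K" "\<And>x. x \<notin> {a..b} \<Longrightarrow> h x = 0"
  shows "integrable lebesgue (\<lambda>x. f x * h x)"
proof -
  note [measurable] = h(1)
  have f': "integrable lebesgue (\<lambda>x. indicator {a..b} x * f x)"
    using f by (simp add: set_integrable_def)
  have "integrable lebesgue (\<lambda>x. (indicator {a..b} x * f x) * h x)"
  proof (rule Bochner_Integration.integrable_bound)
    show "integrable lebesgue (\<lambda>x. K * (indicator {a..b} x * f x))"
      using f' by simp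
    show "(\<lambda>x. (indicator {a..b} x * f x) * h x) \<in> borel_measurable lebesgue"
      using borel_measurable_integrable[OF f'] by measurable
    have "\<bar>y * h x\<bar> \<le> \<bar>K * y\<bar>" for x y
      using h(2)[of x] by (simp add: abs_mult mult.commute[of K] mult_left_mono)
    then show "AE x in lebesgue. norm ((indicator {a..b} x * f x) * h x)
        \<le> norm (K * (indicator {a..b} x * f x))"
      by (simp del: mult.assoc mult.left_commute)
  qed
  also have "(\<lambda>x. (indicator {a..b} x * f x) * h x) = (\<lambda>x. f x * h x)"
    using h(3) by (fastforce simp: indicator_def)
  finally show ?thesis .
qed

lemma set_integral_Ioo_Ioc:
  fixes f :: "real \<Rightarrow> real"
  assumes "f \<in> borel_measurable lebesgue"
  shows "(LINT x:{a<..<b}|lebesgue. f x) = (LINT x:{a<..b}|lebesgue. f x)"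
proof (rule set_integral_cong_set)
  have "AE x in lebesgue. x \<noteq> b"
    by (intro AE_completion AE_lborel_singleton)
  then show "AE x in lebesgue. (x \<in> {a<..b}) = (x \<in> {a<..<b})"
    by eventually_elim auto
qed (unfold set_borel_measurable_def,
    (intro borel_measurable_scaleR borel_measurable_indicator assms, simp)+)

text \<open>Testing the weak derivative with \<^const>\<open>plateau\<close> gives \<open>\<integral> g \<cdot> plateau = 0\<close>, because the derivative
  of the plateau is a difference of two translates by the period and \<open>w\<close> is periodic. Dominated
  convergence then turns the plateau into the indicator of the period. The argument
  rests on the periodicity of \<open>w\<close> and not of \<open>g\<close>, which is determined only almost everywhere.\<close>

lemma H1_per_mean_zero:
  assumes "H1_per L w g" and "L > 0"
  shows "(LINT x:{0<..<L}|lebesgue. g x) = 0"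
proof -
  have w: "\<And>a b. set_integrable lebesgue {a..b} w" and g: "\<And>a b. set_integrable lebesgue {a..b} g"
    and gm[measurable]: "g \<in> borel_measurable lebesgue"
    and per: "\<And>x. w (x + L) = w x" and weak: "weak_derivative w g"
    using assms(1) by (auto simp: H1_per_def L2_loc_set_integrable L2_loc_def)
  have sm: "(\<lambda>x. smooth_step' (real (Suc n) * (x - c))) \<in> borel_measurable lebesgue" for n c
  proof -
    have "continuous_on UNIV (\<lambda>x. smooth_step' (real (Suc n) * (x - c)))"
      by (intro continuous_intros continuous_on_compose2[OF continuous_smooth_step'[of UNIV]]) auto
    from borel_measurable_continuous_onI[OF this] show ?thesis
      by (intro measurable_completion) simp
  qed
  have sup: "smooth_step' (real (Suc n) * (x - c)) = 0" if "x \<notin> {c..c+1}" for n c x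
  proof (cases "x < c")
    case True
    then have "real (Suc n) * (x - c) < 0" by (simp add: mult_pos_neg del: of_nat_Suc)
    then show ?thesis by (intro smooth_step'_support) auto
  next
    case False
    then have "1 * 1 < real (Suc n) * (x - c)" using that by (intro mult_le_less_imp_less) auto
    then show ?thesis by (intro smooth_step'_support) auto
  qed
  have bd: "\<bar>smooth_step' s\<bar> \<le> 4" for s
    by (auto simp: smooth_step'_def max_def abs_if)
  have int: "integrable lebesgue (\<lambda>x. w x * smooth_step' (real (Suc n) * (x - c)))" for n c
    by (rule integrable_mult_bounded_support[OF w sm bd sup])
  have zero: "(LINT x|lebesgue. g x * plateau L n x) = 0" for n
  proof -
    \<comment> \<open>translation by one period leaves \<open>w\<close> unchanged\<close>
    have "(LINT x|lebesgue. w x * smooth_step' (real (Suc n) * (x - L)))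
        = (LINT x|lebesgue. w x * smooth_step' (real (Suc n) * x))"
      by (subst lebesgue_integral_real_affine[where c=1 and t=L])
        (auto simp: per add.commute[of L])
    then have "(LINT x|lebesgue. real (Suc n) * (w x * smooth_step' (real (Suc n) * x)
        - w x * smooth_step' (real (Suc n) * (x - L)))) = 0"
      using int[of n 0] int[of n L] by (simp del: of_nat_Suc)
    also have "(\<lambda>x. real (Suc n) * (w x * smooth_step' (real (Suc n) * x)
        - w x * smooth_step' (real (Suc n) * (x - L)))) = (\<lambda>x. w x * deriv (plateau L n) x)"
      by (simp only: DERIV_imp_deriv[OF plateau_deriv]) (simp add: algebra_simps)
    finally show ?thesis
      using weak test_function_plateau[of L n] assms(2) unfolding weak_derivative_def by auto
  qed
  have "(\<lambda>n. LINT x|lebesgue. g x * plateau L n x) \<longlonglongrightarrow> (LINT x|lebesgue. g x * indicator {0<..L} x)"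
  proof (rule integral_dominated_convergence)
    show "integrable lebesgue (\<lambda>x. \<bar>g x\<bar> * indicator {0..L+1} x)"
      using integrable_abs[OF g[of 0 "L+1", unfolded set_integrable_def]]
      by (simp add: abs_mult mult.commute)
    show "AE x in lebesgue. (\<lambda>n. g x * plateau L n x) \<longlonglongrightarrow> g x * indicator {0<..L} x"
      using assms(2) by (intro AE_I2 tendsto_mult tendsto_const plateau_tendsto) auto
    have cont: "continuous_on UNIV (plateau L n)" for n
      by (intro continuous_at_imp_continuous_on ballI DERIV_isCont[OF plateau_deriv])
    then have [measurable]: "plateau L n \<in> borel_measurable lebesgue" for n
      using borel_measurable_continuous_onI[OF cont] by (intro measurable_completion) simp
    show "(\<lambda>x. g x * plateau L n x) \<in> borel_measurable lebesgue" for n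
      by measurable
    show "AE x in lebesgue. norm (g x * plateau L n x) \<le> \<bar>g x\<bar> * indicator {0..L+1} x" for n
    proof (rule AE_I2)
      fix x
      show "norm (g x * plateau L n x) \<le> \<bar>g x\<bar> * indicator {0..L+1} x"
        using plateau_support[of L x n] plateau_bound[of L n x] assms(2)
        by (cases "x \<in> {0..L+1}") (auto simp: abs_mult mult_left_le)
    qed
  qed (intro borel_measurable_times gm borel_measurable_indicator, simp)
  then have "(LINT x|lebesgue. g x * indicator {0<..L} x) = 0"
    by (simp add: zero LIMSEQ_const_iff)
  then show ?thesis
    by (subst set_integral_Ioo_Ioc) (auto simp: set_lebesgue_integral_def mult.commute)
qed

section \<open>Primitives of bounded periodic functions\<close>

lemma bounded_borel_set_integrable:
  fixes f :: "real \<Rightarrow> real"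
  assumes [measurable]: "f \<in> borel_measurable borel" and "\<And>x. \<bar>f x\<bar> \<le> K"
    and "A \<in> sets borel" and "emeasure lborel A < \<infinity>"
  shows "set_integrable lborel A f"
  unfolding set_integrable_def
  by (rule integrableI_bounded_set_indicator[where B=K]) (use assms in \<open>auto\<close>)

lemma bounded_borel_L2_loc:
  fixes f :: "real \<Rightarrow> real"
  assumes [measurable]: "f \<in> borel_measurable borel"
    and bd: "\<And>a b. \<exists>K. \<forall>x\<in>{a..b}. \<bar>f x\<bar> \<le> K"
  shows "L2_loc f"
  unfolding L2_loc_def
proof (intro conjI allI)
  show "f \<in> borel_measurable lebesgue"
    by (intro measurable_completion) simp
  fix a b
  obtain K where K: "\<And>x. x \<in> {a..b} \<Longrightarrow> \<bar>f x\<bar> \<le> K" using bd[of a b] by blast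
  have "set_integrable lborel {a..b} (\<lambda>x. (f x)\<^sup>2)"
    unfolding set_integrable_def
  proof (rule integrableI_bounded_set_indicator[where B="K\<^sup>2"])
    show "AE x in lborel. x \<in> {a..b} \<longrightarrow> norm ((f x)\<^sup>2) \<le> K\<^sup>2"
      using K by (auto intro!: AE_I2 simp: abs_le_square_iff[symmetric] intro: order_trans[OF _ abs_ge_self])
  qed (auto simp: emeasure_lborel_Icc_eq)
  then show "set_integrable lebesgue {a..b} (\<lambda>x. (f x)\<^sup>2)"
    unfolding set_integrable_def by (subst integrable_completion) auto
qed

lemma lborel_set_integral_shift:
  fixes f :: "real \<Rightarrow> real"
  shows "(LINT t:{a+L<..b+L}|lborel. f t) = (LINT t:{a<..b}|lborel. f (t + L))"
  unfolding set_lebesgue_integral_def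
  by (subst lborel_integral_real_affine[where c=1 and t=L])
    (auto simp: indicator_def algebra_simps intro!: Bochner_Integration.integral_cong)

text \<open>The interval integral is signed, so that the primitive is defined to the left of \<open>0\<close> as well.\<close>

definition primitive :: "(real \<Rightarrow> real) \<Rightarrow> real \<Rightarrow> real" where
  "primitive g x = (LBINT t=ereal 0..ereal x. g t)"

lemma primitive_0: "primitive g 0 = 0"
  by (simp add: primitive_def)

lemma primitive_diff:
  assumes g: "g \<in> borel_measurable borel" "\<And>x. \<bar>g x\<bar> \<le> K" and "c \<le> x"
  shows "primitive g x - primitive g c = (LINT t:{c<..x}|lborel. g t)"
proof -
  have "interval_lebesgue_integrable lborel (min 0 (min (ereal c) (ereal x)))
      (max 0 (max (ereal c) (ereal x))) g"
  proof -
    obtain a b where "min 0 (min (ereal c) (ereal x)) = ereal a"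
      and "max 0 (max (ereal c) (ereal x)) = ereal b" and "a \<le> b"
      by (rule that[of "min 0 (min c x)" "max 0 (max c x)"])
        (auto simp: min_def max_def zero_ereal_def)
    then show ?thesis
      unfolding interval_lebesgue_integrable_def
      by (auto intro!: bounded_borel_set_integrable[OF g])
  qed
  then have "(LBINT t=0..ereal c. g t) + (LBINT t=ereal c..ereal x. g t) = (LBINT t=0..ereal x. g t)"
    by (rule interval_integral_sum)
  then show ?thesis
    using \<open>c \<le> x\<close> by (simp add: primitive_def interval_integral_Ioc zero_ereal_def)
qed

lemma primitive_lipschitz:
  assumes g: "g \<in> borel_measurable borel" "\<And>x. \<bar>g x\<bar> \<le> K"
  shows "\<bar>primitive g x - primitive g y\<bar> \<le> K * \<bar>x - y\<bar>"
proof -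
  have "\<bar>primitive g b - primitive g a\<bar> \<le> K * (b - a)" if "a \<le> b" for a b
  proof -
    have int: "set_integrable lborel {a<..b} g" "set_integrable lborel {a<..b} (\<lambda>_. K)"
      using that by (auto intro!: bounded_borel_set_integrable[OF g] bounded_borel_set_integrable[of _ "\<bar>K\<bar>"])
    have "\<bar>LINT t:{a<..b}|lborel. g t\<bar> \<le> (LINT t:{a<..b}|lborel. \<bar>g t\<bar>)"
      using set_integral_norm_bound[OF int(1)] by simp
    also have "\<dots> \<le> (LINT t:{a<..b}|lborel. K)"
      using int g(2) by (intro set_integral_mono set_integrable_abs) auto
    finally have "\<bar>LINT t:{a<..b}|lborel. g t\<bar> \<le> (LINT t:{a<..b}|lborel. K)" .
    then show ?thesis
      using that by (simp add: primitive_diff[OF g that] set_lebesgue_integral_def mult.commute)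
  qed
  from this[of x y] this[of y x] show ?thesis
    by (cases "x \<le> y") (auto simp: abs_minus_commute)
qed

lemma primitive_continuous:
  assumes g: "g \<in> borel_measurable borel" "\<And>x. \<bar>g x\<bar> \<le> K"
  shows "continuous_on UNIV (primitive g)"
proof (rule lipschitz_on_continuous_on)
  show "K-lipschitz_on UNIV (primitive g)"
    using primitive_lipschitz[OF g] g(2)[of 0] by (auto intro!: lipschitz_onI simp: dist_real_def)
qed

text \<open>The increment over one period is the same from every starting point, and it vanishes at \<open>0\<close>.\<close>

lemma primitive_periodic:
  assumes g: "g \<in> borel_measurable borel" "\<And>x. \<bar>g x\<bar> \<le> K"
    and per: "\<And>x. g (x + L) = g x" and zero: "(LINT t:{0<..L}|lborel. g t) = 0" and "L \<ge> 0"
  shows "primitive g (x + L) = primitive g x"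
proof -
  have eq: "primitive g (b + L) - primitive g b = primitive g (a + L) - primitive g a" if "a \<le> b" for a b
    using primitive_diff[OF g, of "a + L" "b + L"] primitive_diff[OF g that] that
      lborel_set_integral_shift[of a L b g] by (simp add: per)
  have "primitive g L = 0"
    using primitive_diff[OF g \<open>L \<ge> 0\<close>] zero by (simp add: primitive_0)
  then show ?thesis
    using eq[of 0 x] eq[of x 0] by (cases "0 \<le> x") (auto simp: primitive_0)
qed

lemma test_function_vanishes_outside:
  assumes "test_function \<phi>"
  obtains R where "R > 0" "\<And>x. \<bar>x\<bar> \<ge> R \<Longrightarrow> \<phi> x = 0" "\<And>x. \<bar>x\<bar> \<ge> R \<Longrightarrow> deriv \<phi> x = 0"
proof -
  have "bounded {x. \<phi> x \<noteq> 0}"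
    using assms unfolding test_function_def
    by (meson bounded_subset closure_subset compact_imp_bounded)
  then obtain r where r: "\<And>x. \<phi> x \<noteq> 0 \<Longrightarrow> \<bar>x\<bar> \<le> r" 
    by (auto simp: bounded_iff)
  have "deriv \<phi> x = 0" if "\<bar>x\<bar> > r" for x
  proof -
    have "open {y. r < \<bar>y\<bar>}" by (intro open_Collect_less continuous_intros)
    moreover have "((\<lambda>_. 0) has_real_derivative 0) (at x)" by simp
    ultimately have "(\<phi> has_real_derivative 0) (at x)"
      using that r by (elim has_field_derivative_transform_within_open) force+
    then show ?thesis by (rule DERIV_imp_deriv)
  qed
  then show ?thesis
    using r by (intro that[of "\<bar>r\<bar> + 1"]) force+
qed

lemma test_function_deriv:
  assumes "test_function \<phi>"
  shows "(\<phi> has_real_derivative deriv \<phi> x) (at x)" "continuous_on UNIV (deriv \<phi>)"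
proof -
  from assms obtain D where D: "\<And>x. (\<phi> has_vector_derivative D x) (at x)" "continuous_on UNIV D"
    by (auto simp: test_function_def C1_differentiable_on_def)
  then have *: "(\<phi> has_real_derivative D x) (at x)" for x
    by (simp add: has_real_derivative_iff_has_vector_derivative)
  then have "deriv \<phi> = D" by (auto intro: DERIV_imp_deriv)
  with * D show "(\<phi> has_real_derivative deriv \<phi> x) (at x)" "continuous_on UNIV (deriv \<phi>)"
    by auto
qed

text \<open>Integration by parts for an absolutely continuous function. Write \<open>w(x) = w(-R) + \<integral> g\<close> over
  \<open>(-R, x]\<close>, where \<open>\<phi>\<close> is supported in \<open>(-R, R)\<close>, and exchange the order of integration: the inner integral
  over \<open>x\<close> becomes \<open>\<integral> \<phi>'\<close> over \<open>[t, R]\<close>, which is \<open>-\<phi>(t)\<close>. Fubini's theorem takes the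
  place of the product rule because \<open>g\<close> is merely measurable.\<close>

lemma primitive_weak_derivative:
  assumes g: "g \<in> borel_measurable borel" "\<And>x. \<bar>g x\<bar> \<le> K"
  shows "weak_derivative (primitive g) g"
  unfolding weak_derivative_def
proof (intro allI impI)
  fix \<phi> assume test: "test_function \<phi>"
  obtain R where R: "R > 0" "\<And>x. \<bar>x\<bar> \<ge> R \<Longrightarrow> \<phi> x = 0" "\<And>x. \<bar>x\<bar> \<ge> R \<Longrightarrow> deriv \<phi> x = 0"
    using test_function_vanishes_outside[OF test] by blast
  let ?D = "deriv \<phi>"
  note D = test_function_deriv[OF test]
  note [measurable] = g(1) borel_measurable_continuous_onI[OF D(2)]
  have [measurable]: "\<phi> \<in> borel_measurable borel"
    by (intro borel_measurable_continuous_onI continuous_at_imp_continuous_on ballI DERIV_isCont[OF D(1)])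
  note [measurable] = borel_measurable_continuous_onI[OF primitive_continuous[OF g]]
  obtain K' where K': "\<And>x. \<bar>?D x\<bar> \<le> K'"
  proof -
    have "compact (?D ` {-R..R})"
      by (intro compact_continuous_image continuous_on_subset[OF D(2)]) auto
    then obtain k where "\<And>y. y \<in> ?D ` {-R..R} \<Longrightarrow> \<bar>y\<bar> \<le> k"
      by (metis bounded_iff compact_imp_bounded real_norm_def)
    then have "\<bar>?D x\<bar> \<le> max k 0" for x
      using R(3)[of x] by (cases "x \<in> {-R..R}") (force simp: le_max_iff_disj)+
    then show ?thesis by (rule that)
  qed
  have supp: "?D x = 0" if "x \<notin> {-R..R}" for x
    using that R(1) R(3)[of x] by (cases "x < 0") auto
  have FTC: "(LBINT x. ?D x * indicator {t..R} x) = - \<phi> t" if "t \<le> R" for t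
    using integral_FTC_Icc_real[OF that, of \<phi> ?D] R(2)[of R] R(1) D
    by (auto simp: continuous_on_eq_continuous_at)
  have D_int: "integrable lborel (\<lambda>x. ?D x * indicator {-R..R} x)"
    using bounded_borel_set_integrable[of ?D K' "{-R..R}"] K'
    by (simp add: set_integrable_def mult.commute emeasure_lborel_Icc_eq)
  \<comment> \<open>the integrand on the triangle \<open>-R < t \<le> x \<le> R\<close>, to be integrated in both orders\<close>
  define F where "F x t = indicator {-R<..R} t * indicator {t..R} x * (g t * ?D x)" for x t
  have F_meas: "(\<lambda>(x, t). F x t) \<in> borel_measurable (lborel \<Otimes>\<^sub>M lborel)"
  proof -
    have "(\<lambda>p. indicator {p :: real \<times> real. snd p \<le> fst p} p * indicator {..R} (fst p) 
       * indicator {-R<..R} (snd p) * (g (snd p) * ?D (fst p))) \<in> borel_measurable (lborel \<Otimes>\<^sub>M lborel)"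
      by measurable
    also have "(\<lambda>p. indicator {p :: real \<times> real. snd p \<le> fst p} p * indicator {..R} (fst p) 
       * indicator {-R<..R} (snd p) * (g (snd p) * ?D (fst p))) = (\<lambda>(x, t). F x t)"
      by (auto simp: F_def indicator_def)
    finally show ?thesis .
  qed
  have F_int: "integrable (lborel \<Otimes>\<^sub>M lborel) (\<lambda>(x, t). F x t)"
  proof (rule Bochner_Integration.integrable_bound)
    show "integrable (lborel \<Otimes>\<^sub>M lborel) (\<lambda>p. (K * K') * indicator ({-R..R} \<times> {-R..R}) p :: real)"
    proof (intro integrable_mult_right integrable_real_indicator)
      have "emeasure (lborel \<Otimes>\<^sub>M lborel) ({-R..R} \<times> {-R..R}) = ennreal (2*R) * ennreal (2*R)"
        using R(1) by (subst lborel.emeasure_pair_measure_Times) auto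
      also have "\<dots> < \<infinity>" by (simp add: ennreal_mult_less_top)
      finally show "emeasure (lborel \<Otimes>\<^sub>M lborel) ({-R..R} \<times> {-R..R}) < \<infinity>" .
    qed simp
    show "AE p in lborel \<Otimes>\<^sub>M lborel. norm (case p of (x, t) \<Rightarrow> F x t)
        \<le> norm (K * K' * indicator ({-R..R} \<times> {-R..R}) p)"
    proof (rule AE_I2, clarify)
      fix x t
      have "\<bar>g t\<bar> * \<bar>?D x\<bar> \<le> K * K'"
        using g(2)[of t] K'[of x] by (intro mult_mono) auto
      moreover from this have "0 \<le> K * K'" by (rule order_trans[rotated]) simp
      ultimately show "norm (F x t) \<le> norm (K * K' * indicator ({-R..R} \<times> {-R..R}) (x, t))"
        by (auto simp: F_def indicator_def abs_mult[of "g t"])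
    qed
  qed (rule F_meas)
  have inner_t: "(LBINT t. F x t) = (primitive g x - primitive g (-R)) * ?D x" for x
  proof (cases "x \<in> {-R..R}")
    case True
    have "(LBINT t. F x t) = (LBINT t. indicator {-R<..x} t * g t * ?D x)"
      using True by (intro Bochner_Integration.integral_cong) (auto simp: F_def indicator_def)
    also have "\<dots> = (LINT t:{-R<..x}|lborel. g t) * ?D x"
      by (simp add: set_lebesgue_integral_def)
    finally show ?thesis using primitive_diff[OF g, of "-R" x] True by simp
  next
    case False
    then show ?thesis by (simp add: F_def supp)
  qed
  have inner_x: "(LBINT x. F x t) = - (g t * \<phi> t)" for t
  proof (cases "t \<in> {-R<..R}")
    case True
    have "(LBINT x. F x t) = (LBINT x. g t * (?D x * indicator {t..R} x))"
      using True by (intro Bochner_Integration.integral_cong) (auto simp: F_def)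
    then show ?thesis using FTC[of t] True by simp
  next
    case False
    then have "\<phi> t = 0" using R(2)[of t] by (cases "t < 0") auto
    then show ?thesis using False by (simp add: F_def)
  qed
  have "- (LBINT t. g t * \<phi> t) = (LBINT t. (LBINT x. F x t))"
    by (simp add: inner_x)
  also have "\<dots> = (LBINT x. (LBINT t. F x t))"
    by (rule lborel_pair.Fubini_integral[OF F_int])
  also have "\<dots> = (LBINT x. primitive g x * ?D x - primitive g (-R) * (?D x * indicator {-R..R} x))"
  proof (intro Bochner_Integration.integral_cong refl)
    fix x
    show "(LBINT t. F x t) = primitive g x * ?D x - primitive g (-R) * (?D x * indicator {-R..R} x)"
      using supp[of x] by (cases "x \<in> {-R..R}") (auto simp: inner_t algebra_simps)
  qed
  also have "\<dots> = (LBINT x. primitive g x * ?D x) - primitive g (-R) * (LBINT x. ?D x * indicator {-R..R} x)"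
  proof (subst Bochner_Integration.integral_diff)
    have "compact (primitive g ` {-R..R})"
      by (intro compact_continuous_image continuous_on_subset[OF primitive_continuous[OF g]]) auto
    then obtain k where k: "\<And>y. y \<in> primitive g ` {-R..R} \<Longrightarrow> \<bar>y\<bar> \<le> k"
      by (metis bounded_iff compact_imp_bounded real_norm_def)
    have "\<bar>primitive g 0\<bar> \<le> k" using R(1) by (intro k imageI) simp
    then have k0: "0 \<le> k" by linarith
    have "integrable lborel (\<lambda>x. indicator {-R..R} x *\<^sub>R (primitive g x * ?D x))"
    proof (rule integrableI_bounded_set_indicator[where B="k * K'"])
      show "AE x in lborel. x \<in> {-R..R} \<longrightarrow> norm (primitive g x * ?D x) \<le> k * K'"
        using k K' k0 by (auto intro!: AE_I2 mult_mono simp: abs_mult)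
    qed (auto simp: emeasure_lborel_Icc_eq)
    also have "(\<lambda>x. indicator {-R..R} x *\<^sub>R (primitive g x * ?D x)) = (\<lambda>x. primitive g x * ?D x)"
    proof
      fix x
      show "indicator {-R..R} x *\<^sub>R (primitive g x * ?D x) = primitive g x * ?D x"
        using supp[of x] by (cases "x \<in> {-R..R}") auto
    qed
    finally show "integrable lborel (\<lambda>x. primitive g x * ?D x)" .
  qed (use D_int in auto)
  also have "\<dots> = (LBINT x. primitive g x * ?D x)"
    using FTC[of "-R"] R(1) R(2)[of "-R"] by simp
  finally show "(LINT x|lebesgue. primitive g x * ?D x) = - (LINT x|lebesgue. g x * \<phi> x)"
    by (simp add: integral_completion)
qed

lemma H1_per_primitive:
  assumes g: "g \<in> borel_measurable borel" "\<And>x. \<bar>g x\<bar> \<le> K"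
    and per: "\<And>x. g (x + L) = g x" and zero: "(LINT t:{0<..<L}|lebesgue. g t) = 0" and "L \<ge> 0"
  shows "H1_per L (primitive g) g"
  unfolding H1_per_def
proof (intro conjI allI)
  note [measurable] = g(1)
  show "L2_loc g"
    using g by (intro bounded_borel_L2_loc) auto
  have cont: "continuous_on UNIV (primitive g)" by (rule primitive_continuous[OF g])
  show "L2_loc (primitive g)"
  proof (rule bounded_borel_L2_loc)
    show "primitive g \<in> borel_measurable borel" using cont by (rule borel_measurable_continuous_onI)
    fix a b
    have "compact (primitive g ` {a..b})"
      by (intro compact_continuous_image continuous_on_subset[OF cont]) auto
    then show "\<exists>K. \<forall>x\<in>{a..b}. \<bar>primitive g x\<bar> \<le> K"
      by (metis bounded_iff compact_imp_bounded real_norm_def image_eqI)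
  qed
  have "g \<in> borel_measurable lebesgue" by (intro measurable_completion) simp
  then have "(LINT t:{0<..L}|lebesgue. g t) = 0" using zero by (simp add: set_integral_Ioo_Ioc)
  then have "(LINT t:{0<..L}|lborel. g t) = 0"
    unfolding set_lebesgue_integral_def by (subst (asm) integral_completion) auto
  then show "primitive g (x + L) = primitive g x" for x
    using assms by (intro primitive_periodic[OF g]) auto
  show "weak_derivative (primitive g) g" by (rule primitive_weak_derivative[OF g])
qed

section \<open>The homogenized coefficient is the harmonic mean\<close>

text \<open>The corrector is a primitive, and it should be periodic at every point and Borel measurable. The
  coefficient is therefore replaced by an almost everywhere equal one: a Borel version, truncated so that
  the bounds hold everywhere, and then copied from the period \<open>(0, L)\<close> to the whole line.\<close>

lemma periodic_borel_representative:
  fixes A :: "real \<Rightarrow> real"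
  assumes "A \<in> borel_measurable lebesgue" and bounds: "\<And>x. \<alpha> \<le> A x" "\<And>x. A x \<le> \<beta>" and "L > 0"
  obtains a where "a \<in> borel_measurable borel" "\<And>x. \<alpha> \<le> a x" "\<And>x. a x \<le> \<beta>"
    "\<And>x. a (x + L) = a x" "AE x in lebesgue. x \<in> {0<..<L} \<longrightarrow> a x = A x"
proof -
  obtain A' where A'[measurable]: "A' \<in> borel_measurable borel" and ae: "AE x in lborel. A x = A' x"
    using completion_ex_borel_measurable_real[OF assms(1)] by auto
  define a where "a x = max \<alpha> (min \<beta> (A' (L * (x / L - of_int \<lfloor>x / L\<rfloor>))))" for x
  have \<alpha>\<beta>: "\<alpha> \<le> \<beta>" using bounds[of 0] by linarith
  show ?thesis
  proof
    show "a \<in> borel_measurable borel" unfolding a_def by measurable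
    show "\<alpha> \<le> a x" "a x \<le> \<beta>" for x using \<alpha>\<beta> by (auto simp: a_def)
    have "(x + L) / L = x / L + of_int 1" for x using \<open>L > 0\<close> by (simp add: field_simps)
    then show "a (x + L) = a x" for x unfolding a_def by (simp only: floor_add_int[symmetric]) simp
    have fl: "x / L - of_int \<lfloor>x / L\<rfloor> = x / L" if "x \<in> {0<..<L}" for x
    proof -
      have "\<lfloor>x / L\<rfloor> = 0" using that by (intro floor_unique) auto
      then show ?thesis by simp
    qed
    have "a x = A x" if "x \<in> {0<..<L}" "A x = A' x" for x
      unfolding a_def fl[OF that(1)] using that bounds[of x] \<open>L > 0\<close> by simp
    then have "AE x in lborel. x \<in> {0<..<L} \<longrightarrow> a x = A x"
      using ae by eventually_elim (use \<open>\<And>x. \<lbrakk>x \<in> {0<..<L}; A x = A' x\<rbrakk> \<Longrightarrow> a x = A x\<close> in blast)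
    then show "AE x in lebesgue. x \<in> {0<..<L} \<longrightarrow> a x = A x"
      by (rule AE_completion)
  qed
qed

lemma bounded_lebesgue_set_integrable:
  fixes f :: "real \<Rightarrow> real"
  assumes "f \<in> borel_measurable lebesgue" and "\<And>x. \<bar>f x\<bar> \<le> K"
  shows "set_integrable lebesgue {a<..<b} f"
  unfolding set_integrable_def
  by (rule integrableI_bounded_set_indicator[where B=K])
    (use assms in \<open>auto simp: emeasure_lborel_box_eq box_real[symmetric] simp del: box_real\<close>)

text \<open>In one dimension the flux \<open>A (p + w')\<close> of a solution is constant, which makes the homogenized coefficient the
  harmonic mean. The constant is identified without showing that the flux is constant: with
  \<open>c = L / \<integral> 1/A\<close> the function \<open>c / A - 1\<close> is bounded and has mean zero, so it is an admissible
  gradient. As a test gradient it gives \<open>\<integral> flux = c \<integral> flux / A = c \<integral> (p + w') = c p L\<close> for every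
  solution; multiplied by \<open>p\<close> it is itself the gradient of a solution, because the flux is then
  \<open>c p\<close> and gradients of periodic functions have mean zero.\<close>

lemma hom_coeff_eq_harmonic_mean:
  fixes A :: "real \<Rightarrow> real"
  assumes "L > 0" and A: "A \<in> borel_measurable lebesgue"
    and "\<alpha> > 0" and bounds: "\<And>x. \<alpha> \<le> A x" "\<And>x. A x \<le> \<beta>"
  shows "hom_coeff L A = L / (LINT x:{0<..<L}|lebesgue. 1 / A x)"
proof -
  obtain a where a: "a \<in> borel_measurable borel" "\<And>x. \<alpha> \<le> a x" "\<And>x. a x \<le> \<beta>"
    "\<And>x. a (x + L) = a x" and ae: "AE x in lebesgue. x \<in> {0<..<L} \<longrightarrow> a x = A x"
    using periodic_borel_representative[OF A bounds \<open>L > 0\<close>] by blast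
  note [measurable] = a(1)
  have a_leb: "a \<in> borel_measurable lebesgue" by (intro measurable_completion) simp
  have pos: "a x > 0" "A x > 0" for x using a(2)[of x] bounds(1)[of x] \<open>\<alpha> > 0\<close> by linarith+
  have nz: "a x \<noteq> 0" "A x \<noteq> 0" for x using pos[of x] by simp_all
  have inv_bd: "\<bar>1 / a x\<bar> \<le> 1 / \<alpha>" for x
    using a(2)[of x] \<open>\<alpha> > 0\<close> pos(1)[of x] by (simp add: frac_le)
  define I where "I = (LINT x:{0<..<L}|lebesgue. 1 / A x)"
  define c where "c = L / I"
  have int_inv: "set_integrable lebesgue {0<..<L} (\<lambda>x. 1 / a x)"
    using a_leb inv_bd by (intro bounded_lebesgue_set_integrable) auto
  have const: "set_integrable lebesgue {0<..<L} (\<lambda>_. k)" "(LINT x:{0<..<L}|lebesgue. k) = k * L" for k :: real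
    using \<open>L > 0\<close> by (auto intro!: bounded_lebesgue_set_integrable[of _ "\<bar>k\<bar>"] simp: set_lebesgue_integral_def)
  have I: "(LINT x:{0<..<L}|lebesgue. 1 / a x) = I"
    unfolding I_def using ae A a_leb by (intro set_lebesgue_integral_cong_AE) auto
  have "I > 0"
  proof -
    have "(1 / \<beta>) * L \<le> (LINT x:{0<..<L}|lebesgue. 1 / a x)"
      using int_inv const a(2,3) pos by (subst const(2)[symmetric], intro set_integral_mono) (auto intro!: frac_le)
    moreover have "(1 / \<beta>) * L > 0"
      using \<open>L > 0\<close> pos(1)[of 0] a(3)[of 0] by simp
    ultimately show ?thesis using I by simp
  qed
  have corrector: "\<exists>w. H1_per L w (\<lambda>x. p * (c / a x - 1))" for p
  proof -
    let ?g = "\<lambda>x. p * (c / a x - 1)"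
    have "H1_per L (primitive ?g) ?g"
    proof (rule H1_per_primitive)
      show "\<bar>?g x\<bar> \<le> \<bar>p\<bar> * (\<bar>c\<bar> * (1 / \<alpha>) + 1)" for x
      proof -
        have "\<bar>c / a x\<bar> \<le> \<bar>c\<bar> * (1 / \<alpha>)"
          using mult_left_mono[OF inv_bd[of x], of "\<bar>c\<bar>"] by (simp add: abs_mult)
        then have "\<bar>c / a x - 1\<bar> \<le> \<bar>c\<bar> * (1 / \<alpha>) + 1" by linarith
        then show ?thesis by (simp only: abs_mult mult_left_mono abs_ge_zero)
      qed
      have "(LINT x:{0<..<L}|lebesgue. c * (1 / a x) - 1) = c * I - 1 * L"
        by (subst set_integral_diff(2)[OF set_integrable_mult_right[OF int_inv] const(1)])
          (simp only: const set_integral_mult_right I)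
      then have "(LINT x:{0<..<L}|lebesgue. p * (c * (1 / a x) - 1)) = p * (c * I - L)"
        by simp
      also have "\<dots> = 0" using \<open>I > 0\<close> by (simp add: c_def)
      finally show "(LINT x:{0<..<L}|lebesgue. ?g x) = 0" by simp
    qed (use a(4) \<open>L > 0\<close> in auto)
    then show ?thesis by blast
  qed
  have flux: "(1 / L) * (LINT x:{0<..<L}|lebesgue. A x * (p + g x)) = c * p"
    if sol: "periodic_weak_solution L A p w g" for p w g
  proof -
    have H: "H1_per L w g" using sol by (simp add: periodic_weak_solution_def)
    then have g: "g \<in> borel_measurable lebesgue" "set_integrable lebesgue {0..L} g"
      by (auto simp: H1_per_def L2_loc_set_integrable L2_loc_def)
    have g': "set_integrable lebesgue {0<..<L} g"
      by (rule set_integrable_subset[OF g(2)]) auto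
    have int: "set_integrable lebesgue {0<..<L} (\<lambda>x. A x * (p + g x))"
    proof (rule set_integrable_bound)
      show "set_integrable lebesgue {0<..<L} (\<lambda>x. \<beta> * (\<bar>p\<bar> + \<bar>g x\<bar>))"
        using g' const by (intro set_integrable_mult_right set_integral_add set_integrable_abs) auto
      have "\<bar>A x * (p + g x)\<bar> \<le> \<bar>\<beta> * (\<bar>p\<bar> + \<bar>g x\<bar>)\<bar>" for x
        using bounds(2)[of x] pos(2)[of x] by (auto simp: abs_mult intro!: mult_mono)
      then show "AE x in lebesgue. x \<in> {0<..<L} \<longrightarrow>
          norm (A x * (p + g x)) \<le> norm (\<beta> * (\<bar>p\<bar> + \<bar>g x\<bar>))" by auto
      show "set_borel_measurable lebesgue {0<..<L} (\<lambda>x. A x * (p + g x))"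
        unfolding set_borel_measurable_def
        by (intro borel_measurable_scaleR borel_measurable_indicator borel_measurable_times A
            borel_measurable_add g(1) borel_measurable_const) simp
    qed
    from corrector[of 1] obtain w0 where "H1_per L w0 (\<lambda>x. c / a x - 1)" by auto
    then have "0 = (LINT x:{0<..<L}|lebesgue. A x * (p + g x) * (c / a x - 1))"
      using sol by (simp add: periodic_weak_solution_def)
    also have "\<dots> = (LINT x:{0<..<L}|lebesgue. c * (p + g x) - A x * (p + g x))"
    proof (rule set_lebesgue_integral_cong_AE)
      show "AE x in lebesgue. x \<in> {0<..<L} \<longrightarrow>
          A x * (p + g x) * (c / a x - 1) = c * (p + g x) - A x * (p + g x)"
        using ae by eventually_elim (simp add: nz field_simps)
    qed (use A g a_leb in auto)
    also have "\<dots> = c * (p * L + 0) - (LINT x:{0<..<L}|lebesgue. A x * (p + g x))"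
      using int g' const H1_per_mean_zero[OF H \<open>L > 0\<close>] by (simp add: set_integral_diff set_integral_add)
    finally show ?thesis using \<open>L > 0\<close> by (simp add: field_simps)
  qed
  have exist: "\<exists>w g. periodic_weak_solution L A p w g" for p
  proof -
    obtain w where w: "H1_per L w (\<lambda>x. p * (c / a x - 1))" using corrector by blast
    have "(LINT x:{0<..<L}|lebesgue. A x * (p + p * (c / a x - 1)) * \<psi> x) = 0"
      if \<psi>: "H1_per L \<phi> \<psi>" for \<phi> \<psi>
    proof -
      have \<psi>m: "\<psi> \<in> borel_measurable lebesgue" using \<psi> by (simp add: H1_per_def L2_loc_def)
      have "(LINT x:{0<..<L}|lebesgue. A x * (p + p * (c / a x - 1)) * \<psi> x)
          = (LINT x:{0<..<L}|lebesgue. p * c * \<psi> x)"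
      proof (rule set_lebesgue_integral_cong_AE)
        show "AE x in lebesgue. x \<in> {0<..<L} \<longrightarrow>
            A x * (p + p * (c / a x - 1)) * \<psi> x = p * c * \<psi> x"
          using ae by eventually_elim (simp add: nz field_simps)
      qed (use A \<psi>m a_leb in auto)
      then show ?thesis using H1_per_mean_zero[OF \<psi> \<open>L > 0\<close>] by simp
    qed
    with w show ?thesis unfolding periodic_weak_solution_def by blast
  qed
  show ?thesis
    unfolding hom_coeff_def I_def[symmetric] c_def[symmetric]
  proof (rule the_equality)
    show "\<forall>p. \<exists>w g. periodic_weak_solution L A p w g \<and>
        c * p = 1 / L * (LINT x:{0<..<L}|lebesgue. A x * (p + g x))"
      using exist flux by metis
    fix h assume "\<forall>p. \<exists>w g. periodic_weak_solution L A p w g \<and>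
        h * p = 1 / L * (LINT x:{0<..<L}|lebesgue. A x * (p + g x))"
    then have "h * 1 = c * 1" using flux[of 1] by metis
    then show "h = c" by simp
  qed
qed

section \<open>Coefficients with defects\<close>

text \<open>Both the random coefficient and the coefficients with a single defect choose \<open>C\<close> on some cells and
  \<open>A\<close> elsewhere. Cells are open, so integer points keep the value of \<open>A\<close>.\<close>

definition defect_coefficient ::
  "(real \<Rightarrow> real) \<Rightarrow> (real \<Rightarrow> real) \<Rightarrow> (int \<Rightarrow> bool) \<Rightarrow> real \<Rightarrow> real" where
  "defect_coefficient A C b x = (if of_int \<lfloor>x\<rfloor> < x \<and> b \<lfloor>x\<rfloor> then C x else A x)"

lemma mem_cell_iff: "x \<in> cell k \<longleftrightarrow> of_int \<lfloor>x\<rfloor> < x \<and> k = \<lfloor>x\<rfloor>"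
proof
  assume "x \<in> cell k"
  then have x: "of_int k < x" "x < of_int k + 1" by (auto simp: cell_def)
  then have "\<lfloor>x\<rfloor> = k" by (intro floor_unique) auto
  with x show "of_int \<lfloor>x\<rfloor> < x \<and> k = \<lfloor>x\<rfloor>" by simp
qed (simp add: cell_def)

lemma A_rand_eq_defect_coefficient:
  "A_rand A C B \<omega> = defect_coefficient A C (\<lambda>k. B k \<omega>)"
proof
  fix x
  have "(\<Sum>\<^sub>\<infinity>k. indicator (cell k) x * of_bool (B k \<omega>) :: real)
      = (\<Sum>\<^sub>\<infinity>k\<in>{\<lfloor>x\<rfloor>}. indicator (cell k) x * of_bool (B k \<omega>))"
    by (rule infsum_cong_neutral) (auto simp: mem_cell_iff)
  also have "\<dots> = indicator (cell \<lfloor>x\<rfloor>) x * of_bool (B \<lfloor>x\<rfloor> \<omega>)"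
    by (subst infsum_finite) (simp, simp only: sum.insert sum.empty finite.emptyI empty_iff not_False_eq_True add_0_right)
  finally show "A_rand A C B \<omega> x = defect_coefficient A C (\<lambda>k. B k \<omega>) x"
    by (simp add: A_rand_def defect_coefficient_def mem_cell_iff indicator_def)
qed

lemma single_defect_eq_defect_coefficient:
  "(\<lambda>x. A x + indicator (cell k) x * (C x - A x)) = defect_coefficient A C (\<lambda>j. j = k)"
  by (auto simp: defect_coefficient_def mem_cell_iff indicator_def fun_eq_iff)

lemma cells_in_eq: "cells_in N = {0..<int N}"
proof -
  have "cell k \<subseteq> {0<..<real N} \<longleftrightarrow> 0 \<le> k \<and> k < int N" for k
    unfolding cell_def greaterThanLessThan_subseteq_greaterThanLessThan by simp linarith
  then show ?thesis by (auto simp: cells_in_def)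
qed

text \<open>Resistances in series add up, whereas conductivities do not: the reciprocal of the
  coefficient is the additive quantity.\<close>

definition mean_resistance :: "(real \<Rightarrow> real) \<Rightarrow> real" where
  "mean_resistance A = (LINT x:{0<..<1}|lebesgue. 1 / A x)"

lemma hom_coeff_periodic:
  assumes "periodic_coefficient A"
  shows "hom_coeff 1 A = 1 / mean_resistance A"
  using assms unfolding periodic_coefficient_def mean_resistance_def
  by (auto intro!: hom_coeff_eq_harmonic_mean)

lemma mean_resistance_pos:
  assumes "periodic_coefficient A"
  shows "mean_resistance A > 0"
proof -
  from assms obtain \<alpha> \<beta> where A: "A \<in> borel_measurable lebesgue" "\<alpha> > 0" "\<And>x. \<alpha> \<le> A x" "\<And>x. A x \<le> \<beta>"
    by (auto simp: periodic_coefficient_def)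
  have pos: "A x > 0" for x using A(2) A(3)[of x] by linarith
  have "(LINT x:{0<..<1::real}|lebesgue. 1 / \<beta>) \<le> (LINT x:{0<..<1}|lebesgue. 1 / A x)"
  proof (rule set_integral_mono)
    show "set_integrable lebesgue {0<..<1::real} (\<lambda>x. 1 / A x)"
      using A pos
      by (intro bounded_lebesgue_set_integrable[where K="1/\<alpha>"] borel_measurable_divide)
        (auto simp: abs_of_pos intro!: frac_le)
    show "set_integrable lebesgue {0<..<1::real} (\<lambda>x. 1 / \<beta>)"
      by (intro bounded_lebesgue_set_integrable[where K="\<bar>1/\<beta>\<bar>"]) auto
  qed (use A(4) pos in \<open>auto intro!: frac_le\<close>)
  moreover have "(LINT x:{0<..<1::real}|lebesgue. 1 / \<beta>) > 0"
    using pos[of 0] A(4)[of 0] by (simp add: set_lebesgue_integral_def)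
  ultimately show ?thesis by (simp add: mean_resistance_def)
qed

lemma periodic_cell_resistance:
  assumes "periodic_coefficient A"
  shows "(LINT x:cell k|lebesgue. 1 / A x) = mean_resistance A"
proof -
  have "A (of_int k + x) = A x" for x
    using assms by (simp add: periodic_coefficient_def add.commute)
  then show ?thesis
    unfolding mean_resistance_def set_lebesgue_integral_def cell_def
    by (subst lebesgue_integral_real_affine[where c=1 and t="of_int k"])
      (auto intro!: Bochner_Integration.integral_cong simp: indicator_def)
qed

lemma defect_coefficient_measurable:
  assumes "A \<in> borel_measurable lebesgue" "C \<in> borel_measurable lebesgue"
  shows "defect_coefficient A C b \<in> borel_measurable lebesgue"
proof -
  have [measurable]: "Measurable.pred borel (\<lambda>x::real. b \<lfloor>x\<rfloor>)"
    by (rule measurable_compose[OF measurable_real_floor]) simp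
  have "Measurable.pred borel (\<lambda>x::real. of_int \<lfloor>x\<rfloor> < x \<and> b \<lfloor>x\<rfloor>)"
    by measurable
  then have "Measurable.pred lebesgue (\<lambda>x::real. of_int \<lfloor>x\<rfloor> < x \<and> b \<lfloor>x\<rfloor>)"
    by (intro measurable_completion) simp
  then show ?thesis
    unfolding defect_coefficient_def using assms by (intro measurable_If) (auto simp: pred_def)
qed

text \<open>By periodicity each cell contributes one of two numbers to \<open>\<integral> 1/A\<close>, so the apparent coefficient depends on
  the configuration of defects only through their number.\<close>

lemma hom_coeff_defects:
  assumes A: "periodic_coefficient A" and C: "periodic_coefficient C" and "N \<ge> 1"
  shows "hom_coeff (real N) (defect_coefficient A C b) =
    real N / (\<Sum>k=0..<int N. if b k then mean_resistance C else mean_resistance A)"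
proof -
  let ?D = "defect_coefficient A C b"
  from A obtain \<alpha> \<beta> where A': "A \<in> borel_measurable lebesgue" "\<alpha> > 0" "\<And>x. \<alpha> \<le> A x" "\<And>x. A x \<le> \<beta>"
    by (auto simp: periodic_coefficient_def)
  from C obtain \<alpha>' \<beta>' where C': "C \<in> borel_measurable lebesgue" "\<alpha>' > 0" "\<And>x. \<alpha>' \<le> C x" "\<And>x. C x \<le> \<beta>'"
    by (auto simp: periodic_coefficient_def)
  have D: "?D \<in> borel_measurable lebesgue" by (rule defect_coefficient_measurable[OF A'(1) C'(1)])
  have low: "min \<alpha> \<alpha>' \<le> ?D x" for x
    using A'(3)[of x] C'(3)[of x] by (auto simp: defect_coefficient_def)
  have up: "?D x \<le> max \<beta> \<beta>'" for x
    using A'(4)[of x] C'(4)[of x] by (auto simp: defect_coefficient_def)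
  have pos: "?D x > 0" for x using low[of x] A'(2) C'(2) by linarith
  have inv_m: "(\<lambda>x. 1 / ?D x) \<in> borel_measurable lebesgue"
    using D by (intro borel_measurable_divide) auto
  have inv_bd: "\<bar>1 / ?D x\<bar> \<le> 1 / min \<alpha> \<alpha>'" for x
    using low[of x] pos[of x] A'(2) C'(2) by (simp add: abs_of_pos frac_le del: min_less_iff_conj)
  \<comment> \<open>half-open cells tile the period exactly, the open ones only up to a null set\<close>
  let ?J = "\<lambda>k::int. {of_int k <.. of_int k + 1 :: real}"
  have union: "(\<Union>k\<in>{0..<int N}. ?J k) = {0<..real N}"
  proof (intro equalityI subsetI)
    fix x assume "x \<in> {0<..real N}"
    then have "\<lceil>x\<rceil> - 1 \<in> {0..<int N}" "x \<in> ?J (\<lceil>x\<rceil> - 1)"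
      by (auto simp: ceiling_le_iff le_ceiling_iff) linarith+
    then show "x \<in> (\<Union>k\<in>{0..<int N}. ?J k)" by blast
  next
    fix x assume "x \<in> (\<Union>k\<in>{0..<int N}. ?J k)"
    then obtain k where "0 \<le> k" "k + 1 \<le> int N" "x \<in> ?J k" by auto
    moreover have "of_int (k + 1) \<le> real N" using calculation(2) by linarith
    ultimately show "x \<in> {0<..real N}" by auto
  qed
  have "(LINT x:{0<..<real N}|lebesgue. 1 / ?D x) = (LINT x:(\<Union>k\<in>{0..<int N}. ?J k)|lebesgue. 1 / ?D x)"
    unfolding union by (rule set_integral_Ioo_Ioc[OF inv_m])
  also have "\<dots> = (\<Sum>k=0..<int N. LINT x:?J k|lebesgue. 1 / ?D x)"
  proof (rule set_integral_finite_Union)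
    show "disjoint_family_on ?J {0..<int N}"
      by (auto simp: disjoint_family_on_def)
    show "set_integrable lebesgue (?J k) (\<lambda>x. 1 / ?D x)" for k
      by (rule set_integrable_subset[OF bounded_lebesgue_set_integrable[OF inv_m inv_bd, of "of_int k" "of_int k + 2"]])
        auto
  qed auto
  also have "\<dots> = (\<Sum>k=0..<int N. if b k then mean_resistance C else mean_resistance A)"
  proof (rule sum.cong[OF refl])
    fix k
    have "(LINT x:?J k|lebesgue. 1 / ?D x) = (LINT x:cell k|lebesgue. 1 / ?D x)"
      unfolding cell_def by (rule set_integral_Ioo_Ioc[OF inv_m, symmetric])
    also have "\<dots> = (LINT x:cell k|lebesgue. 1 / (if b k then C x else A x))"
      by (rule set_lebesgue_integral_cong)
        (simp add: cell_def, auto simp: mem_cell_iff defect_coefficient_def)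
    also have "\<dots> = (if b k then mean_resistance C else mean_resistance A)"
      using periodic_cell_resistance[OF A, of k] periodic_cell_resistance[OF C, of k] by (cases "b k") auto
    finally show "(LINT x:?J k|lebesgue. 1 / ?D x) = (if b k then mean_resistance C else mean_resistance A)" .
  qed
  finally show ?thesis
    using hom_coeff_eq_harmonic_mean[OF _ D _ low up] \<open>N \<ge> 1\<close> A'(2) C'(2) by simp
qed

section \<open>Moments of sums of independent variables\<close>

context prob_space begin

lemma bounded_integrable:
  fixes X :: "'a \<Rightarrow> real"
  assumes "X \<in> borel_measurable M" "\<And>\<omega>. \<bar>X \<omega>\<bar> \<le> K"
  shows "integrable M X"
  using assms by (intro integrable_const_bound[where B=K]) auto

lemma indep_power_expectation:
  fixes X Y :: "'a \<Rightarrow> real"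
  assumes indep: "indep_var borel X borel Y"
    and X: "\<And>\<omega>. \<bar>X \<omega>\<bar> \<le> K" and Y: "\<And>\<omega>. \<bar>Y \<omega>\<bar> \<le> K'"
  shows "expectation (\<lambda>\<omega>. X \<omega> ^ a * Y \<omega> ^ b) = expectation (\<lambda>\<omega>. X \<omega> ^ a) * expectation (\<lambda>\<omega>. Y \<omega> ^ b)"
proof (rule indep_var_lebesgue_integral)
  note [measurable] = indep_var_rv1[OF indep] indep_var_rv2[OF indep]
  have "\<bar>X \<omega> ^ a\<bar> \<le> K ^ a" "\<bar>Y \<omega> ^ b\<bar> \<le> K' ^ b" for \<omega>
    using X[of \<omega>] Y[of \<omega>] by (auto simp: power_abs intro!: power_mono)
  then show "integrable M (\<lambda>\<omega>. X \<omega> ^ a)" "integrable M (\<lambda>\<omega>. Y \<omega> ^ b)"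
    by (auto intro!: bounded_integrable)
  show "indep_var borel (\<lambda>\<omega>. X \<omega> ^ a) borel (\<lambda>\<omega>. Y \<omega> ^ b)"
    using indep_var_compose[OF indep, of "\<lambda>x. x ^ a" borel "\<lambda>y. y ^ b" borel] by (simp add: comp_def)
qed

text \<open>Induction on the index set: in the binomial expansion of \<open>(X\<^sub>i + S)\<^sup>n\<close> independence splits every
  mixed moment, and the terms that contain a first moment vanish. For an average of \<open>n\<close> variables
  the third and the fourth moments are both of order \<open>1 / n\<^sup>2\<close>. For the third moment this is
  half an order better than the size of the fluctuations suggests.\<close>

lemma moments_indep_sum:
  fixes X :: "'i \<Rightarrow> 'a \<Rightarrow> real"
  assumes "finite I" and "indep_vars (\<lambda>_. borel) X I"
    and bd: "\<And>i \<omega>. i \<in> I \<Longrightarrow> \<bar>X i \<omega>\<bar> \<le> K"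
    and mean: "\<And>i. i \<in> I \<Longrightarrow> expectation (X i) = 0"
    and m2: "\<And>i. i \<in> I \<Longrightarrow> expectation (\<lambda>\<omega>. X i \<omega> ^ 2) = \<mu>2"
    and m3: "\<And>i. i \<in> I \<Longrightarrow> expectation (\<lambda>\<omega>. X i \<omega> ^ 3) = \<mu>3"
    and m4: "\<And>i. i \<in> I \<Longrightarrow> expectation (\<lambda>\<omega>. X i \<omega> ^ 4) = \<mu>4"
  defines "n \<equiv> real (card I)"
  shows "expectation (\<lambda>\<omega>. \<Sum>i\<in>I. X i \<omega>) = 0"
    and "expectation (\<lambda>\<omega>. (\<Sum>i\<in>I. X i \<omega>) ^ 2) = n * \<mu>2"
    and "expectation (\<lambda>\<omega>. (\<Sum>i\<in>I. X i \<omega>) ^ 3) = n * \<mu>3"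
    and "expectation (\<lambda>\<omega>. (\<Sum>i\<in>I. X i \<omega>) ^ 4) = n * \<mu>4 + 3 * n * (n - 1) * \<mu>2\<^sup>2"
proof -
  let ?S = "\<lambda>I \<omega>. \<Sum>i\<in>I. X i \<omega>"
  have "expectation (?S I) = 0 \<and> expectation (\<lambda>\<omega>. ?S I \<omega> ^ 2) = card I * \<mu>2 \<and>
      expectation (\<lambda>\<omega>. ?S I \<omega> ^ 3) = card I * \<mu>3 \<and>
      expectation (\<lambda>\<omega>. ?S I \<omega> ^ 4) = card I * \<mu>4 + 3 * card I * (real (card I) - 1) * \<mu>2\<^sup>2"
    using \<open>finite I\<close> assms(2-7)
  proof (induction I rule: finite_induct)
    case empty
    then show ?case by simp
  next
    case (insert i I)
    have sub: "indep_vars (\<lambda>_. borel) X I"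
      by (rule indep_vars_subset[OF insert.prems(1)]) auto
    note IH = insert.IH[OF sub insert.prems(2-6)[OF insertI2]]
    define Y where "Y = X i"
    define S where "S = ?S I"
    have indep: "indep_var borel Y borel S"
      unfolding Y_def S_def using indep_vars_sum[OF insert.hyps insert.prems(1)] .
    note [measurable] = indep_var_rv1[OF indep] indep_var_rv2[OF indep]
    have Y: "\<bar>Y \<omega>\<bar> \<le> K" for \<omega> unfolding Y_def by (rule insert.prems(2)) simp
    have S: "\<bar>S \<omega>\<bar> \<le> real (card I) * K" for \<omega>
      unfolding S_def using insert.prems(2) by (intro order_trans[OF sum_abs] sum_bounded_above) auto
    have prod: "expectation (\<lambda>\<omega>. Y \<omega> ^ a * S \<omega> ^ b) = expectation (\<lambda>\<omega>. Y \<omega> ^ a) * expectation (\<lambda>\<omega>. S \<omega> ^ b)" for a b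
      by (rule indep_power_expectation[OF indep Y S])
    have int: "integrable M (\<lambda>\<omega>. Y \<omega> ^ a * S \<omega> ^ b)" for a b
    proof (rule bounded_integrable)
      show "\<bar>Y \<omega> ^ a * S \<omega> ^ b\<bar> \<le> K ^ a * (real (card I) * K) ^ b" for \<omega>
        using Y[of \<omega>] S[of \<omega>] by (auto simp: abs_mult power_abs intro!: mult_mono power_mono)
    qed simp
    have moment: "expectation (\<lambda>\<omega>. \<Sum>k\<le>n. real (n choose k) * (Y \<omega> ^ k * S \<omega> ^ (n - k))) =
        (\<Sum>k\<le>n. real (n choose k) * (expectation (\<lambda>\<omega>. Y \<omega> ^ k) * expectation (\<lambda>\<omega>. S \<omega> ^ (n - k))))" for n
      by (subst Bochner_Integration.integral_sum) (auto simp: int prod)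
    have moment': "expectation (\<lambda>\<omega>. ?S (insert i I) \<omega> ^ n) =
        (\<Sum>k\<le>n. real (n choose k) * (expectation (\<lambda>\<omega>. Y \<omega> ^ k) * expectation (\<lambda>\<omega>. S \<omega> ^ (n - k))))" for n
    proof -
      have "?S (insert i I) \<omega> = Y \<omega> + S \<omega>" for \<omega>
        using insert.hyps by (simp add: S_def Y_def)
      then show ?thesis by (simp add: binomial_ring mult.assoc moment)
    qed
    have Y_moments: "expectation Y = 0" "expectation (\<lambda>\<omega>. Y \<omega> ^ 2) = \<mu>2"
      "expectation (\<lambda>\<omega>. Y \<omega> ^ 3) = \<mu>3" "expectation (\<lambda>\<omega>. Y \<omega> ^ 4) = \<mu>4"
      unfolding Y_def by (rule insert.prems, simp)+
    have S_moments: "expectation S = 0" "expectation (\<lambda>\<omega>. S \<omega> ^ 2) = card I * \<mu>2"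
      "expectation (\<lambda>\<omega>. S \<omega> ^ 3) = card I * \<mu>3"
      "expectation (\<lambda>\<omega>. S \<omega> ^ 4) = card I * \<mu>4 + 3 * card I * (real (card I) - 1) * \<mu>2\<^sup>2"
      unfolding S_def using IH by auto
    have "expectation (?S (insert i I)) = 0"
      using moment'[of 1] Y_moments S_moments by (simp add: prob_space)
    moreover have "expectation (\<lambda>\<omega>. ?S (insert i I) \<omega> ^ 2) = (real (card I) + 1) * \<mu>2"
      unfolding moment' using Y_moments S_moments
      by (simp add: prob_space numeral_2_eq_2 algebra_simps)
    moreover have "expectation (\<lambda>\<omega>. ?S (insert i I) \<omega> ^ 3) = (real (card I) + 1) * \<mu>3"
      unfolding moment' using Y_moments S_moments
      by (simp add: prob_space eval_nat_numeral algebra_simps)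
    moreover have "expectation (\<lambda>\<omega>. ?S (insert i I) \<omega> ^ 4) =
        (real (card I) + 1) * \<mu>4 + 3 * (real (card I) + 1) * real (card I) * \<mu>2\<^sup>2"
      unfolding moment' using Y_moments S_moments
      by (simp add: prob_space eval_nat_numeral algebra_simps)
    ultimately show ?case
      using insert.hyps by (simp add: algebra_simps)
  qed
  then show "expectation (\<lambda>\<omega>. \<Sum>i\<in>I. X i \<omega>) = 0"
    and "expectation (\<lambda>\<omega>. (\<Sum>i\<in>I. X i \<omega>) ^ 2) = n * \<mu>2"
    and "expectation (\<lambda>\<omega>. (\<Sum>i\<in>I. X i \<omega>) ^ 3) = n * \<mu>3"
    and "expectation (\<lambda>\<omega>. (\<Sum>i\<in>I. X i \<omega>) ^ 4) = n * \<mu>4 + 3 * n * (n - 1) * \<mu>2\<^sup>2"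
    by (auto simp: n_def)
qed

end

section \<open>Control variates\<close>

text \<open>If \<open>c = 0\<close> then nonnegativity forces \<open>b = 0\<close>, so the degenerate control variate of variance zero does
  not need a separate argument.\<close>

lemma nonneg_quadratic_attains_min:
  fixes a b c :: real
  assumes "c \<ge> 0" and nonneg: "\<And>x. 0 \<le> a - 2 * b * x + c * x\<^sup>2"
  shows "\<exists>x. is_arg_min (\<lambda>x. a - 2 * b * x + c * x\<^sup>2) (\<lambda>_. True) x"
proof -
  show ?thesis
  proof (cases "c = 0")
    case True
    have "b = 0"
    proof (rule ccontr)
      assume "b \<noteq> 0"
      then show False using nonneg[of "(a + 1) / (2 * b)"] True by simp
    qed
    with True show ?thesis by (simp add: is_arg_min_def)
  next
    case False
    with \<open>c \<ge> 0\<close> have c: "c > 0" by simp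
    have sq: "a - 2 * b * x + c * x\<^sup>2 = a - b\<^sup>2 / c + c * (x - b / c)\<^sup>2" for x
      using c by (simp add: field_simps power2_eq_square)
    show ?thesis
      unfolding is_arg_min_def sq
      by (rule exI[of _ "b / c"]) (use c in \<open>auto simp: not_less\<close>)
  qed
qed

context prob_space begin

lemma variance_linear_combination:
  fixes F Z :: "'a \<Rightarrow> real"
  assumes [measurable]: "F \<in> borel_measurable M" "Z \<in> borel_measurable M"
    and F: "\<And>\<omega>. \<bar>F \<omega>\<bar> \<le> K" and Z: "\<And>\<omega>. \<bar>Z \<omega>\<bar> \<le> K'"
  shows "variance (\<lambda>\<omega>. F \<omega> - \<rho> * Z \<omega>) =
    variance F - 2 * expectation (\<lambda>\<omega>. (F \<omega> - expectation F) * (Z \<omega> - expectation Z)) * \<rho>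
      + variance Z * \<rho>\<^sup>2"
proof -
  define f z where "f \<omega> = F \<omega> - expectation F" and "z \<omega> = Z \<omega> - expectation Z" for \<omega>
  have [measurable]: "f \<in> borel_measurable M" "z \<in> borel_measurable M"
    unfolding f_def z_def by measurable
  have f: "\<bar>f \<omega>\<bar> \<le> K + \<bar>expectation F\<bar>" and z: "\<bar>z \<omega>\<bar> \<le> K' + \<bar>expectation Z\<bar>" for \<omega>
    using F[of \<omega>] Z[of \<omega>] by (auto simp: f_def z_def)
  have prod_int: "integrable M (\<lambda>\<omega>. g \<omega> * h \<omega>)"
    if [measurable]: "g \<in> borel_measurable M" "h \<in> borel_measurable M"
      and g: "\<And>\<omega>. \<bar>g \<omega>\<bar> \<le> k" and h: "\<And>\<omega>. \<bar>h \<omega>\<bar> \<le> l" for g h :: "'a \<Rightarrow> real" and k l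
  proof (rule bounded_integrable)
    show "\<bar>g \<omega> * h \<omega>\<bar> \<le> k * l" for \<omega>
      unfolding abs_mult using g[of \<omega>] h[of \<omega>] by (intro mult_mono) auto
  qed simp
  have int: "integrable M (\<lambda>\<omega>. f \<omega> * f \<omega>)" "integrable M (\<lambda>\<omega>. f \<omega> * z \<omega>)" "integrable M (\<lambda>\<omega>. z \<omega> * z \<omega>)"
    by (rule prod_int[OF _ _ f f] prod_int[OF _ _ f z] prod_int[OF _ _ z z], measurable)+
  have "integrable M F" "integrable M Z"
    by (rule bounded_integrable[OF assms(1) F], rule bounded_integrable[OF assms(2) Z])
  then have "F \<omega> - \<rho> * Z \<omega> - expectation (\<lambda>\<omega>. F \<omega> - \<rho> * Z \<omega>) = f \<omega> - \<rho> * z \<omega>" for \<omega>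
    by (simp add: f_def z_def algebra_simps)
  then have "variance (\<lambda>\<omega>. F \<omega> - \<rho> * Z \<omega>) = expectation (\<lambda>\<omega>. (f \<omega> - \<rho> * z \<omega>)\<^sup>2)"
    by simp
  also have "\<dots> = expectation (\<lambda>\<omega>. f \<omega> * f \<omega> - 2 * \<rho> * (f \<omega> * z \<omega>) + \<rho>\<^sup>2 * (z \<omega> * z \<omega>))"
    by (simp add: power2_eq_square algebra_simps)
  also have "\<dots> = expectation (\<lambda>\<omega>. f \<omega> * f \<omega>) - 2 * \<rho> * expectation (\<lambda>\<omega>. f \<omega> * z \<omega>)
      + \<rho>\<^sup>2 * expectation (\<lambda>\<omega>. z \<omega> * z \<omega>)"
    using int by simp
  finally show ?thesis
    by (simp add: f_def z_def power2_eq_square algebra_simps)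
qed

lemma variance_control_variate_attains_min:
  fixes F Z :: "'a \<Rightarrow> real"
  assumes "F \<in> borel_measurable M" "Z \<in> borel_measurable M"
    and "\<And>\<omega>. \<bar>F \<omega>\<bar> \<le> K" and "\<And>\<omega>. \<bar>Z \<omega>\<bar> \<le> K'"
  shows "\<exists>\<rho>. is_arg_min (\<lambda>\<rho>. variance (\<lambda>\<omega>. F \<omega> - \<rho> * Z \<omega>)) (\<lambda>_. True) \<rho>"
  unfolding variance_linear_combination[OF assms]
proof (rule nonneg_quadratic_attains_min[OF variance_positive])
  show "0 \<le> variance F - 2 * expectation (\<lambda>\<omega>. (F \<omega> - expectation F) * (Z \<omega> - expectation Z)) * \<rho>
      + variance Z * \<rho>\<^sup>2" for \<rho>
    unfolding variance_linear_combination[OF assms, symmetric] by (rule variance_positive)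
qed

end

section \<open>The reciprocal of an affine function of a small random variable\<close>

context prob_space begin

text \<open>The second-order Taylor formula at \<open>Y = 0\<close> is the exact identity
  \<open>1 / (m + \<delta> Y) = 1 / m - (\<delta> / m\<^sup>2) Y + R\<close> with \<open>R = (\<delta>\<^sup>2 / m\<^sup>2) Y\<^sup>2 / (m + \<delta> Y)\<close>. The variance of \<open>R\<close> is bounded by
  a multiple of the fourth moment of \<open>Y\<close>. The covariance of \<open>Y\<close> and \<open>R\<close> needs more care, since Cauchy--Schwarz would
  lose half an order: expanding once more, \<open>Y R = (\<delta>\<^sup>2 / m\<^sup>3) Y\<^sup>3 - (\<delta>\<^sup>3 / m\<^sup>3) Y\<^sup>4 / (m + \<delta> Y)\<close>, which
  leaves only the third and the fourth moment of \<open>Y\<close>.\<close>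

lemma reciprocal_affine_variance:
  fixes Y :: "'a \<Rightarrow> real" and m \<delta> c :: real
  assumes Ym[measurable]: "Y \<in> borel_measurable M" and Yb: "\<And>\<omega>. \<bar>Y \<omega>\<bar> \<le> K"
    and "c > 0" and low: "\<And>\<omega>. c \<le> m + \<delta> * Y \<omega>" and "m > 0"
    and Y1: "expectation Y = 0" and Y2: "expectation (\<lambda>\<omega>. Y \<omega> ^ 2) = v"
    and Y3: "\<bar>expectation (\<lambda>\<omega>. Y \<omega> ^ 3)\<bar> \<le> \<kappa>" and Y4: "expectation (\<lambda>\<omega>. Y \<omega> ^ 4) \<le> \<kappa>"
  shows "variance (\<lambda>\<omega>. 1 / (m + \<delta> * Y \<omega>) + \<delta> / m\<^sup>2 * Y \<omega>) \<le> \<delta>^4 / (m^4 * c\<^sup>2) * \<kappa>"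
    and "\<bar>variance (\<lambda>\<omega>. 1 / (m + \<delta> * Y \<omega>)) - \<delta>\<^sup>2 / m^4 * v\<bar>
      \<le> (2 * \<bar>\<delta>\<bar> / m\<^sup>2 * (\<delta>\<^sup>2 / m^3 + \<bar>\<delta>\<bar>^3 / (m^3 * c)) + \<delta>^4 / (m^4 * c\<^sup>2)) * \<kappa>"
proof -
  define f where "f \<omega> = 1 / (m + \<delta> * Y \<omega>)" for \<omega>
  define R where "R \<omega> = \<delta>\<^sup>2 / m\<^sup>2 * (Y \<omega> ^ 2 * f \<omega>)" for \<omega>
  define a where "a = \<delta> / m\<^sup>2"
  have pos: "m + \<delta> * Y \<omega> > 0" for \<omega> using low[of \<omega>] \<open>c > 0\<close> by linarith
  have f_pos: "0 < f \<omega>" and f_le: "f \<omega> \<le> 1 / c" for \<omega>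
    using pos[of \<omega>] low[of \<omega>] \<open>c > 0\<close> by (auto simp: f_def intro!: frac_le)
  have [measurable]: "f \<in> borel_measurable M" "R \<in> borel_measurable M"
    unfolding f_def R_def by measurable
  have int: "integrable M (\<lambda>\<omega>. Y \<omega> ^ i * f \<omega> ^ j)" for i j
  proof (rule bounded_integrable)
    show "\<bar>Y \<omega> ^ i * f \<omega> ^ j\<bar> \<le> K ^ i * (1 / c) ^ j" for \<omega>
      unfolding abs_mult power_abs using Yb[of \<omega>] f_pos[of \<omega>] f_le[of \<omega>]
      by (intro mult_mono power_mono) auto
  qed simp
  have intY: "integrable M (\<lambda>\<omega>. Y \<omega> ^ i)" for i using int[of i 0] by simp
  have intY1: "integrable M Y" using intY[of 1] by simp
  have R_sq: "R \<omega> ^ 2 = \<delta>^4 / m^4 * (Y \<omega> ^ 4 * f \<omega> ^ 2)" for \<omega>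
    by (simp add: R_def power_mult_distrib power_divide flip: power_mult)
  have fm: "f \<omega> * m = 1 - f \<omega> * \<delta> * Y \<omega>" for \<omega>
    using pos[of \<omega>] by (simp add: f_def field_simps)
  have YR: "Y \<omega> * R \<omega> = \<delta>\<^sup>2 / m^3 * Y \<omega> ^ 3 - \<delta>^3 / m^3 * (Y \<omega> ^ 4 * f \<omega>)" for \<omega>
  proof -
    have "\<delta>\<^sup>2 * Y \<omega> ^ 3 * (f \<omega> * m) = \<delta>\<^sup>2 * Y \<omega> ^ 3 * (1 - f \<omega> * \<delta> * Y \<omega>)"
      by (simp only: fm)
    then show ?thesis
      using \<open>m > 0\<close> by (simp add: R_def field_simps power2_eq_square power3_eq_cube power4_eq_xxxx)
  qed
  have expand: "f \<omega> + a * Y \<omega> = 1 / m + R \<omega>" for \<omega>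
  proof -
    have "m * (f \<omega> * m) + \<delta> * Y \<omega> = m * (1 - f \<omega> * \<delta> * Y \<omega>) + \<delta> * Y \<omega>"
      by (simp only: fm)
    also have "\<dots> = m - \<delta> * Y \<omega> * (f \<omega> * m) + \<delta> * Y \<omega>"
      by (simp add: algebra_simps)
    also have "\<dots> = m + \<delta>\<^sup>2 * (Y \<omega> ^ 2 * f \<omega>)"
      unfolding fm by (simp add: algebra_simps power2_eq_square)
    finally show ?thesis
      using \<open>m > 0\<close> by (simp add: a_def R_def field_simps power2_eq_square)
  qed
  have intR: "integrable M R" "integrable M (\<lambda>\<omega>. R \<omega> ^ 2)" "integrable M (\<lambda>\<omega>. Y \<omega> * R \<omega>)"
    unfolding R_sq YR using int[of 2 1] int[of 4 2] int[of 4 1] intY[of 3] by (auto simp: R_def[abs_def])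
  have "Y \<omega> ^ 4 * f \<omega> ^ 2 \<le> Y \<omega> ^ 4 * (1 / c)\<^sup>2" for \<omega>
    using f_pos[of \<omega>] f_le[of \<omega>] by (intro mult_left_mono power_mono) auto
  then have "expectation (\<lambda>\<omega>. Y \<omega> ^ 4 * f \<omega> ^ 2) \<le> expectation (\<lambda>\<omega>. Y \<omega> ^ 4 * (1 / c)\<^sup>2)"
    using int[of 4 2] intY[of 4] by (intro integral_mono) auto
  also have "\<dots> \<le> \<kappa> * (1 / c)\<^sup>2"
    using Y4 by (simp add: mult_right_mono)
  finally have "\<delta>^4 / m^4 * expectation (\<lambda>\<omega>. Y \<omega> ^ 4 * f \<omega> ^ 2) \<le> \<delta>^4 / m^4 * (\<kappa> * (1 / c)\<^sup>2)"
    by (intro mult_left_mono) auto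
  then have ER2: "expectation (\<lambda>\<omega>. R \<omega> ^ 2) \<le> \<delta>^4 / (m^4 * c\<^sup>2) * \<kappa>"
    unfolding R_sq by (simp add: power_divide)
  have var_R: "variance R = expectation (\<lambda>\<omega>. R \<omega> ^ 2) - (expectation R)\<^sup>2"
    using intR(1,2) by (rule variance_eq)
  have "variance (\<lambda>\<omega>. f \<omega> + a * Y \<omega>) = variance R"
    unfolding expand using intR by (simp add: prob_space)
  also have "\<dots> \<le> \<delta>^4 / (m^4 * c\<^sup>2) * \<kappa>"
    unfolding var_R using ER2 by (smt (verit) zero_le_power2)
  finally show "variance (\<lambda>\<omega>. 1 / (m + \<delta> * Y \<omega>) + \<delta> / m\<^sup>2 * Y \<omega>) \<le> \<delta>^4 / (m^4 * c\<^sup>2) * \<kappa>"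
    by (simp add: f_def a_def)
  have EYR: "\<bar>expectation (\<lambda>\<omega>. Y \<omega> * R \<omega>)\<bar> \<le> (\<delta>\<^sup>2 / m^3 + \<bar>\<delta>\<bar>^3 / (m^3 * c)) * \<kappa>"
  proof -
    have "expectation (\<lambda>\<omega>. Y \<omega> ^ 4 * f \<omega>) \<le> expectation (\<lambda>\<omega>. Y \<omega> ^ 4 * (1 / c))"
      using int[of 4 1] intY[of 4] f_le by (intro integral_mono mult_left_mono) auto
    also have "\<dots> \<le> \<kappa> * (1 / c)"
      using Y4 \<open>c > 0\<close> by (simp add: divide_right_mono)
    finally have up: "expectation (\<lambda>\<omega>. Y \<omega> ^ 4 * f \<omega>) \<le> \<kappa> / c" by simp
    moreover have "0 \<le> expectation (\<lambda>\<omega>. Y \<omega> ^ 4 * f \<omega>)"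
      using f_pos by (intro integral_nonneg_AE AE_I2 mult_nonneg_nonneg) (auto intro: less_imp_le)
    ultimately have "\<bar>\<delta>^3 / m^3 * expectation (\<lambda>\<omega>. Y \<omega> ^ 4 * f \<omega>)\<bar> \<le> \<bar>\<delta>\<bar>^3 / m^3 * (\<kappa> / c)"
      unfolding abs_mult using \<open>m > 0\<close> by (intro mult_mono) (auto simp: power_abs)
    moreover have "\<bar>\<delta>\<^sup>2 / m^3 * expectation (\<lambda>\<omega>. Y \<omega> ^ 3)\<bar> \<le> \<delta>\<^sup>2 / m^3 * \<kappa>"
      unfolding abs_mult using \<open>m > 0\<close> Y3 by (intro mult_mono) auto
    moreover have "expectation (\<lambda>\<omega>. Y \<omega> * R \<omega>) =
        \<delta>\<^sup>2 / m^3 * expectation (\<lambda>\<omega>. Y \<omega> ^ 3) - \<delta>^3 / m^3 * expectation (\<lambda>\<omega>. Y \<omega> ^ 4 * f \<omega>)"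
      unfolding YR using int[of 4 1] intY[of 3] by simp
    ultimately have "\<bar>expectation (\<lambda>\<omega>. Y \<omega> * R \<omega>)\<bar>
        \<le> \<delta>\<^sup>2 / m^3 * \<kappa> + \<bar>\<delta>\<bar>^3 / m^3 * (\<kappa> / c)" by linarith
    also have "\<dots> = (\<delta>\<^sup>2 / m^3 + \<bar>\<delta>\<bar>^3 / (m^3 * c)) * \<kappa>" by (simp add: distrib_right)
    finally show ?thesis .
  qed
  have f_eq: "f \<omega> = 1 / m + R \<omega> - a * Y \<omega>" for \<omega> using expand[of \<omega>] by simp
  have "expectation f = expectation (\<lambda>\<omega>. 1 / m + R \<omega> - a * Y \<omega>)"
    by (rule Bochner_Integration.integral_cong[OF refl f_eq])
  also have "\<dots> = 1 / m + expectation R"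
    using intR intY1 Y1 by (simp add: prob_space)
  finally have "f \<omega> - expectation f = (R \<omega> - expectation R) - a * Y \<omega>" for \<omega>
    by (simp add: f_eq)
  then have "variance f = expectation (\<lambda>\<omega>. (R \<omega> - expectation R - a * Y \<omega>)\<^sup>2)" by simp
  also have "\<dots> = expectation (\<lambda>\<omega>. R \<omega> ^ 2 - 2 * expectation R * R \<omega> + (expectation R)\<^sup>2
      - 2 * a * (Y \<omega> * R \<omega>) + 2 * a * expectation R * Y \<omega> + a\<^sup>2 * Y \<omega> ^ 2)"
    by (intro Bochner_Integration.integral_cong) (auto simp: power2_eq_square algebra_simps)
  also have "\<dots> = variance R - 2 * a * expectation (\<lambda>\<omega>. Y \<omega> * R \<omega>) + a\<^sup>2 * v"
    unfolding var_R using intR intY1 intY[of 2] Y1 Y2 by (simp add: prob_space power2_eq_square)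
  finally have "variance f - a\<^sup>2 * v = variance R - 2 * a * expectation (\<lambda>\<omega>. Y \<omega> * R \<omega>)" by simp
  moreover have "0 \<le> variance R" by (rule variance_positive)
  moreover have "variance R \<le> \<delta>^4 / (m^4 * c\<^sup>2) * \<kappa>"
    unfolding var_R using ER2 by (smt (verit) zero_le_power2)
  moreover have "\<bar>2 * a * expectation (\<lambda>\<omega>. Y \<omega> * R \<omega>)\<bar>
      \<le> 2 * \<bar>\<delta>\<bar> / m\<^sup>2 * ((\<delta>\<^sup>2 / m^3 + \<bar>\<delta>\<bar>^3 / (m^3 * c)) * \<kappa>)"
    unfolding abs_mult a_def using EYR by (intro mult_mono) auto
  ultimately have "\<bar>variance f - a\<^sup>2 * v\<bar>
      \<le> 2 * \<bar>\<delta>\<bar> / m\<^sup>2 * ((\<delta>\<^sup>2 / m^3 + \<bar>\<delta>\<bar>^3 / (m^3 * c)) * \<kappa>) + \<delta>^4 / (m^4 * c\<^sup>2) * \<kappa>"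
    by linarith
  moreover have "a\<^sup>2 = \<delta>\<^sup>2 / m^4" by (simp add: a_def power_divide flip: power_mult)
  ultimately show "\<bar>variance (\<lambda>\<omega>. 1 / (m + \<delta> * Y \<omega>)) - \<delta>\<^sup>2 / m^4 * v\<bar>
      \<le> (2 * \<bar>\<delta>\<bar> / m\<^sup>2 * (\<delta>\<^sup>2 / m^3 + \<bar>\<delta>\<bar>^3 / (m^3 * c)) + \<delta>^4 / (m^4 * c\<^sup>2)) * \<kappa>"
    by (simp add: f_def[abs_def] distrib_right mult.assoc)
qed

end

section \<open>Variances of the apparent homogenized coefficient\<close>

lemma bigo_inverse_square:
  fixes f :: "nat \<Rightarrow> real"
  assumes "\<And>N. N \<ge> 1 \<Longrightarrow> \<bar>f N\<bar> \<le> K / (real N)\<^sup>2"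
  shows "f \<in> O(\<lambda>N. 1 / (real N)\<^sup>2)"
  by (rule bigoI[of _ K]) (use assms in \<open>auto intro!: eventually_sequentiallyI[of 1]\<close>)

theorem proposition11:
  fixes Aper Cper :: "real \<Rightarrow> real"
    and \<eta> :: real
    and M :: "'w measure"
    and B :: "int \<Rightarrow> 'w \<Rightarrow> bool"
  assumes "periodic_coefficient Aper"
    and "periodic_coefficient Cper"
    and "0 < \<eta>" and "\<eta> < 1"
    and "prob_space M"
    and "prob_space.indep_vars M (\<lambda>_. count_space UNIV) B UNIV"
    and "\<And>k. distr M (count_space UNIV) (B k) = measure_pmf (bernoulli_pmf \<eta>)"
  shows "(\<exists>C. (\<lambda>N. prob_space.variance M (A_star Aper Cper B N) - C / real N)
               \<in> O(\<lambda>N. 1 / (real N)\<^sup>2)) \<and>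
         (\<forall>N\<ge>1. \<exists>\<rho>. is_arg_min (\<lambda>\<rho>. prob_space.variance M (D_one Aper Cper \<eta> B N \<rho>)) (\<lambda>_. True) \<rho>) \<and>
         (\<forall>\<rho>star. (\<forall>N\<ge>1. is_arg_min (\<lambda>\<rho>. prob_space.variance M (D_one Aper Cper \<eta> B N \<rho>))
                             (\<lambda>_. True) (\<rho>star N)) \<longrightarrow>
           (\<lambda>N. prob_space.variance M (D_one Aper Cper \<eta> B N (\<rho>star N)))
             \<in> O(\<lambda>N. 1 / (real N)\<^sup>2))"
proof -
  interpret prob_space M by fact
  have B_meas[measurable]: "B k \<in> measurable M (count_space UNIV)" for k
    using assms(6) by (auto simp: indep_vars_def)
  define \<alpha> \<beta> where "\<alpha> = mean_resistance Aper" and "\<beta> = mean_resistance Cper"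
  have "\<alpha> > 0" "\<beta> > 0"
    using mean_resistance_pos assms(1,2) by (auto simp: \<alpha>_def \<beta>_def)
  define \<delta> m c where "\<delta> = \<beta> - \<alpha>" and "m = \<alpha> + \<delta> * \<eta>" and "c = min \<alpha> \<beta>"
  have "c > 0" using \<open>\<alpha> > 0\<close> \<open>\<beta> > 0\<close> by (simp add: c_def)
  have "m = (1 - \<eta>) * \<alpha> + \<eta> * \<beta>" by (simp add: m_def \<delta>_def algebra_simps)
  then have "m > 0"
    using \<open>\<alpha> > 0\<close> \<open>\<beta> > 0\<close> assms(3,4) by (simp add: add_pos_pos)
  define X where "X k \<omega> = of_bool (B k \<omega>) - \<eta>" for k \<omega>
  define Y where "Y N \<omega> = (\<Sum>k=0..<int N. X k \<omega>) / real N" for N \<omega>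
  have X_bound: "\<bar>X k \<omega>\<bar> \<le> 1" for k \<omega>
    using assms(3,4) by (simp add: X_def)
  have X_indep: "indep_vars (\<lambda>_. borel) X UNIV"
    using indep_vars_compose2[OF assms(6), of "\<lambda>_ b. of_bool b - \<eta>" "\<lambda>_. borel"]
    by (simp add: X_def[abs_def])
  have X_moment: "expectation (\<lambda>\<omega>. X k \<omega> ^ j) = \<eta> * (1 - \<eta>) ^ j + (1 - \<eta>) * (- \<eta>) ^ j" for k j
  proof -
    have "expectation (\<lambda>\<omega>. X k \<omega> ^ j) = (\<integral>b. (of_bool b - \<eta>) ^ j \<partial>distr M (count_space UNIV) (B k))"
      unfolding X_def by (subst integral_distr) auto
    then show ?thesis
      using assms(3,4) by (simp add: assms(7))
  qed
  define \<mu> where "\<mu> j = \<eta> * (1 - \<eta>) ^ j + (1 - \<eta>) * (- \<eta>) ^ j" for j :: nat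
  have Y_moments: "expectation (Y N) = 0" "expectation (\<lambda>\<omega>. Y N \<omega> ^ 2) = \<mu> 2 / N"
      "\<bar>expectation (\<lambda>\<omega>. Y N \<omega> ^ 3)\<bar> \<le> (\<bar>\<mu> 3\<bar> + \<bar>\<mu> 4\<bar> + 3 * (\<mu> 2)\<^sup>2) / (real N)\<^sup>2"
      "expectation (\<lambda>\<omega>. Y N \<omega> ^ 4) \<le> (\<bar>\<mu> 3\<bar> + \<bar>\<mu> 4\<bar> + 3 * (\<mu> 2)\<^sup>2) / (real N)\<^sup>2" if "N \<ge> 1" for N
  proof -
    have sum: "indep_vars (\<lambda>_. borel) X {0..<int N}"
      by (rule indep_vars_subset[OF X_indep]) simp
    have mean: "expectation (X k) = 0" for k
      using X_moment[of k 1] by (simp add: algebra_simps)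
    note S = moments_indep_sum[OF finite_atLeastLessThan_int sum X_bound mean
        X_moment[of _ 2, folded \<mu>_def] X_moment[of _ 3, folded \<mu>_def] X_moment[of _ 4, folded \<mu>_def]]
    show "expectation (Y N) = 0" "expectation (\<lambda>\<omega>. Y N \<omega> ^ 2) = \<mu> 2 / N"
      using S(1,2) \<open>N \<ge> 1\<close> by (simp_all add: Y_def[abs_def] power_divide power2_eq_square)
    have "expectation (\<lambda>\<omega>. Y N \<omega> ^ 3) = \<mu> 3 / (real N)\<^sup>2"
      using S(3) \<open>N \<ge> 1\<close> by (simp add: Y_def power_divide power2_eq_square power3_eq_cube)
    then show "\<bar>expectation (\<lambda>\<omega>. Y N \<omega> ^ 3)\<bar> \<le> (\<bar>\<mu> 3\<bar> + \<bar>\<mu> 4\<bar> + 3 * (\<mu> 2)\<^sup>2) / (real N)\<^sup>2"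
      by (simp add: divide_right_mono)
    have "real N * \<mu> 4 + 3 * real N * (real N - 1) * (\<mu> 2)\<^sup>2
        \<le> (real N)\<^sup>2 * \<bar>\<mu> 4\<bar> + 3 * (real N)\<^sup>2 * (\<mu> 2)\<^sup>2"
    proof (rule add_mono)
      have "real N * \<mu> 4 \<le> real N * \<bar>\<mu> 4\<bar>" by (intro mult_left_mono) auto
      also have "\<dots> \<le> (real N)\<^sup>2 * \<bar>\<mu> 4\<bar>"
        using \<open>N \<ge> 1\<close> by (intro mult_right_mono) (auto simp: power2_eq_square)
      finally show "real N * \<mu> 4 \<le> (real N)\<^sup>2 * \<bar>\<mu> 4\<bar>" .
      show "3 * real N * (real N - 1) * (\<mu> 2)\<^sup>2 \<le> 3 * (real N)\<^sup>2 * (\<mu> 2)\<^sup>2"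
        by (intro mult_right_mono) (auto simp: power2_eq_square algebra_simps)
    qed
    then have "expectation (\<lambda>\<omega>. Y N \<omega> ^ 4)
        \<le> ((real N)\<^sup>2 * \<bar>\<mu> 4\<bar> + 3 * (real N)\<^sup>2 * (\<mu> 2)\<^sup>2) / real N ^ 4"
      using S(4) by (simp add: Y_def power_divide divide_right_mono)
    also have "\<dots> = (\<bar>\<mu> 4\<bar> + 3 * (\<mu> 2)\<^sup>2) / (real N)\<^sup>2"
      using \<open>N \<ge> 1\<close> by (simp add: power4_eq_xxxx power2_eq_square field_simps)
    finally show "expectation (\<lambda>\<omega>. Y N \<omega> ^ 4) \<le> (\<bar>\<mu> 3\<bar> + \<bar>\<mu> 4\<bar> + 3 * (\<mu> 2)\<^sup>2) / (real N)\<^sup>2"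
      by (rule order_trans) (simp add: divide_right_mono)
  qed
  define \<kappa> where "\<kappa> = \<bar>\<mu> 3\<bar> + \<bar>\<mu> 4\<bar> + 3 * (\<mu> 2)\<^sup>2"
  have Y_meas[measurable]: "Y N \<in> borel_measurable M" for N
    unfolding Y_def X_def by measurable
  have Y_bound: "\<bar>Y N \<omega>\<bar> \<le> 1" for N \<omega>
  proof -
    have "\<bar>\<Sum>k=0..<int N. X k \<omega>\<bar> \<le> real (card {0..<int N}) * 1"
      by (intro order_trans[OF sum_abs] sum_bounded_above X_bound)
    then show ?thesis by (simp add: Y_def divide_le_eq)
  qed
  have resistance: "(\<Sum>k=0..<int N. if B k \<omega> then \<beta> else \<alpha>) = real N * (m + \<delta> * Y N \<omega>)" if "N \<ge> 1" for N \<omega>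
  proof -
    have "(\<Sum>k=0..<int N. if B k \<omega> then \<beta> else \<alpha>) = (\<Sum>k=0..<int N. m + \<delta> * X k \<omega>)"
      by (intro sum.cong) (auto simp: X_def m_def \<delta>_def algebra_simps)
    also have "\<dots> = real N * m + \<delta> * (\<Sum>k=0..<int N. X k \<omega>)"
      by (simp add: sum.distrib sum_distrib_left)
    finally show ?thesis using that by (simp add: Y_def field_simps)
  qed
  have low: "c \<le> m + \<delta> * Y N \<omega>" if "N \<ge> 1" for N \<omega>
  proof -
    have "real (card {0..<int N}) * c \<le> (\<Sum>k=0..<int N. if B k \<omega> then \<beta> else \<alpha>)"
      by (rule sum_bounded_below) (auto simp: c_def)
    then show ?thesis using that by (simp add: resistance)
  qed
  have A_star: "A_star Aper Cper B N = (\<lambda>\<omega>. 1 / (m + \<delta> * Y N \<omega>))" if "N \<ge> 1" for N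
  proof
    fix \<omega>
    have "A_star Aper Cper B N \<omega> = real N / (real N * (m + \<delta> * Y N \<omega>))"
      unfolding A_star_def A_rand_eq_defect_coefficient hom_coeff_defects[OF assms(1,2) that]
        \<alpha>_def[symmetric] \<beta>_def[symmetric] resistance[OF that] ..
    then show "A_star Aper Cper B N \<omega> = 1 / (m + \<delta> * Y N \<omega>)" using that by simp
  qed
  (* With A_per for all other cells, a single defect shifts the total resistance N \<alpha> by \<delta>,
     wherever it sits: every cell contributes the same amount to the control variate. *)
  define d where "d N = real N / (real N * \<alpha> + \<delta>) - 1 / \<alpha>" for N
  have single_defect: "A_one_def Aper Cper N k = d N" if "N \<ge> 1" "k \<in> {0..<int N}" for N k
  proof -
    have "(\<Sum>j=0..<int N. if j = k then \<beta> else \<alpha>) = (\<Sum>j=0..<int N. \<alpha> + (if j = k then \<delta> else 0))"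
      by (intro sum.cong) (auto simp: \<delta>_def)
    also have "\<dots> = real N * \<alpha> + \<delta>"
      using that(2) by (simp add: sum.distrib)
    finally show ?thesis
      unfolding A_one_def_def A_star_one_defect_def A_star_per_def single_defect_eq_defect_coefficient
        hom_coeff_defects[OF assms(1,2) that(1)] hom_coeff_periodic[OF assms(1)] d_def
        \<alpha>_def[symmetric] \<beta>_def[symmetric] by simp
  qed
  have D_one: "D_one Aper Cper \<eta> B N \<rho> = (\<lambda>\<omega>. 1 / (m + \<delta> * Y N \<omega>) - \<rho> * (d N * real N * Y N \<omega>))"
    if "N \<ge> 1" for N \<rho>
  proof
    fix \<omega>
    have "A_one Aper Cper B N \<omega> - \<eta> * A_one_bar Aper Cper N = (\<Sum>k=0..<int N. d N * X k \<omega>)"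
      unfolding A_one_def A_one_bar_def cells_in_eq X_def sum_distrib_left sum_subtractf[symmetric]
      by (rule sum.cong) (simp_all add: single_defect[OF that] algebra_simps)
    also have "\<dots> = d N * real N * Y N \<omega>"
      unfolding sum_distrib_left[symmetric] using that by (simp add: Y_def)
    finally show "D_one Aper Cper \<eta> B N \<rho> \<omega> = 1 / (m + \<delta> * Y N \<omega>) - \<rho> * (d N * real N * Y N \<omega>)"
      using A_star[OF that] by (simp add: D_one_def)
  qed
  (* The control variate is a multiple of Y, and this choice of \<rho> cancels the linear term of
     1 / (m + \<delta> Y). If \<delta> = 0 both sides vanish. *)
  have d: "\<exists>\<rho>. \<rho> * (d N * real N) = - \<delta> / m\<^sup>2" if "N \<ge> 1" for N
  proof (cases "\<delta> = 0")
    case True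
    then show ?thesis by (intro exI[of _ 0]) simp
  next
    case False
    have "real N * \<alpha> + \<delta> > 0"
    proof -
      have "1 * \<alpha> \<le> real N * \<alpha>" using that \<open>\<alpha> > 0\<close> by (intro mult_right_mono) auto
      then show ?thesis using \<open>\<beta> > 0\<close> by (simp add: \<delta>_def)
    qed
    then have "d N = - \<delta> / (\<alpha> * (real N * \<alpha> + \<delta>))"
      using \<open>\<alpha> > 0\<close> unfolding d_def by (subst diff_frac_eq) (auto simp: algebra_simps)
    then have "d N \<noteq> 0" using False \<open>\<alpha> > 0\<close> \<open>real N * \<alpha> + \<delta> > 0\<close> by simp
    then show ?thesis using that by (intro exI[of _ "- \<delta> / m\<^sup>2 / (d N * real N)"]) simp
  qed
  note expansion = reciprocal_affine_variance[OF Y_meas Y_bound \<open>c > 0\<close> low \<open>m > 0\<close> Y_moments, folded \<kappa>_def]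
  have part1: "(\<lambda>N. variance (A_star Aper Cper B N) - (\<delta>\<^sup>2 / m^4 * \<mu> 2) / real N) \<in> O(\<lambda>N. 1 / (real N)\<^sup>2)"
    by (rule bigo_inverse_square) (use expansion(2) in \<open>simp add: A_star\<close>)
  have part2: "\<exists>\<rho>. is_arg_min (\<lambda>\<rho>. variance (D_one Aper Cper \<eta> B N \<rho>)) (\<lambda>_. True) \<rho>" if "N \<ge> 1" for N
    unfolding D_one[OF that]
  proof (rule variance_control_variate_attains_min)
    show "\<bar>1 / (m + \<delta> * Y N \<omega>)\<bar> \<le> 1 / c" for \<omega>
      using low[OF that, of \<omega>] \<open>c > 0\<close> by (simp add: abs_of_pos frac_le)
    show "\<bar>d N * real N * Y N \<omega>\<bar> \<le> \<bar>d N * real N\<bar> * 1" for \<omega>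
      unfolding abs_mult[of "d N * real N"] by (intro mult_left_mono Y_bound) auto
  qed measurable
  have part3: "(\<lambda>N. variance (D_one Aper Cper \<eta> B N (\<rho>star N))) \<in> O(\<lambda>N. 1 / (real N)\<^sup>2)"
    if min: "\<forall>N\<ge>1. is_arg_min (\<lambda>\<rho>. variance (D_one Aper Cper \<eta> B N \<rho>)) (\<lambda>_. True) (\<rho>star N)" for \<rho>star
  proof (rule bigo_inverse_square)
    fix N :: nat assume N: "N \<ge> 1"
    obtain \<rho> where \<rho>: "\<rho> * (d N * real N) = - \<delta> / m\<^sup>2" using d[OF N] by blast
    have "variance (D_one Aper Cper \<eta> B N (\<rho>star N)) \<le> variance (D_one Aper Cper \<eta> B N \<rho>)"
      using min N by (auto simp: is_arg_min_def not_less)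
    also have "D_one Aper Cper \<eta> B N \<rho> = (\<lambda>\<omega>. 1 / (m + \<delta> * Y N \<omega>) + \<delta> / m\<^sup>2 * Y N \<omega>)"
      unfolding D_one[OF N] mult.assoc[symmetric] using \<rho> by (simp add: mult.assoc)
    also have "variance \<dots> \<le> \<delta>^4 / (m^4 * c\<^sup>2) * \<kappa> / (real N)\<^sup>2"
      using expansion(1)[OF N N N N N] by simp
    finally show "\<bar>variance (D_one Aper Cper \<eta> B N (\<rho>star N))\<bar> \<le> \<delta>^4 / (m^4 * c\<^sup>2) * \<kappa> / (real N)\<^sup>2"
      using variance_positive by simp
  qed
  show ?thesis
    using part1 part2 part3 by blast
qed

end
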